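(* Let $n$ be a natural number with $n\geq 2$. Let ${\mathcal C}$ be an $n$-chord diagram on the unit circle ${\mathbb S}^1$ with counterclockwise orientation. Let $f:K_{4n}\to{\mathbb R}^2$ be a generic immersion of the complete graph on $4n$ vertices. Then there exist a cycle $\gamma$ of $K_{4n}$ containing exactly $4n$ vertices (with a suitable orientation) and a sub-chord diagram ${\mathcal D}$ of the chord diagram ${\mathcal C}(f|_\gamma)$ such that ${\mathcal D}$ is equivalent to ${\mathcal C}$.
   Context: Everything is in the piecewise linear category. $K_m$ denotes the complete graph on $m$ vertices; a finite graph is regarded as a topological space in the usual way. A cycle of a graph is a subgraph homeomorphic to a circle. A generic immersion of a finite graph $G$ is a continuous (piecewise linear) map $f:G\to{\mathbb R}^2$ whose multiple points are only finitely many transversal double points of interior points of edges (the two preimages of a double point may lie on the same edge, on adjacent edges or on disjoint edges). A circle is considered as a graph, so generic immersions of circles are defined in the same way. The restriction of a generic immersion of $G$ to a cycle $\gamma$ of $G$ is a generic immersion of the circle $\gamma$. An $n$-chord diagram on an oriented circle $S$ is a set of $2n$ distinct points of $S$ partitioned into $n$ pairs; a chord diagram is an $n$-chord diagram for some $n$. Two $n$-chord diagrams ${\mathcal C}_1$ on an oriented circle $S_1$ and ${\mathcal C}_2$ on an oriented circle $S_2$ are equivalent if there is an orientation preserving homeomorphism $S_1\to S_2$ mapping each pair of points of ${\mathcal C}_1$ to a pair of points of ${\mathcal C}_2$. A sub-chord diagram of a chord diagram ${\mathcal C}$ on $S$ is a chord diagram on $S$ whose pairs of points are pairs of points of ${\mathcal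 C}$. For an oriented circle $S$ and a generic immersion $f:S\to{\mathbb R}^2$, ${\mathcal C}(f)$ denotes the chord diagram on $S$ whose pairs of points are the pairs of preimages of the double points of $f$. *)

theory Defs
  imports "HOL-Complex_Analysis.Complex_Analysis" "HOL-Library.Disjoint_Sets"
begin

section \<open>Finite simple graphs and their geometric realizations\<close>

type_synonym 'v graph = "'v set \<times> 'v set set"

definition verts :: "'v graph \<Rightarrow> 'v set" where
  "verts G = fst G"

definition edges :: "'v graph \<Rightarrow> 'v set set" where
  "edges G = snd G"

definition simple_graph :: "'v graph \<Rightarrow> bool" where
  "simple_graph G \<longleftrightarrow> finite (verts G) \<and> (\<forall>e\<in>edges G. e \<subseteq> verts G \<and> card e = 2)"

text \<open>The complete graph whose vertices are all elements of the finite type \<open>'v\<close>; it is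
  \<open>K_m\<close> for \<open>m = CARD('v)\<close>.\<close>

definition complete_graph :: "'v::finite graph" where
  "complete_graph = (UNIV, {e. card e = 2})"

definition subgraph :: "'v graph \<Rightarrow> 'v graph \<Rightarrow> bool" where
  "subgraph H G \<longleftrightarrow> simple_graph H \<and> verts H \<subseteq> verts G \<and> edges H \<subseteq> edges G"

text \<open>The vertices are placed at the standard basis vectors, so that any two edges meet
  at most in a common endpoint.\<close>

definition vertex_point :: "'v::finite \<Rightarrow> real ^ 'v" where
  "vertex_point v = axis v 1"

definition edge_segment :: "'v::finite set \<Rightarrow> (real ^ 'v) set" where
  "edge_segment e = convex hull (vertex_point ` e)"

definition realization :: "'v::finite graph \<Rightarrow> (real ^ 'v) set" where
  "realization G = vertex_point ` verts G \<union> (\<Union>e\<in>edges G. edge_segment e)"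

definition edge_interiors :: "'v::finite graph \<Rightarrow> (real ^ 'v) set" where
  "edge_interiors G = (\<Union>e\<in>edges G. rel_interior (edge_segment e))"

definition cycle_of :: "'v::finite graph \<Rightarrow> 'v graph \<Rightarrow> bool" where
  "cycle_of \<gamma> G \<longleftrightarrow> subgraph \<gamma> G \<and> realization \<gamma> homeomorphic sphere (0::complex) 1"


section \<open>Generic immersions\<close>

definition piecewise_linear_on ::
  "'a::euclidean_space set \<Rightarrow> ('a \<Rightarrow> 'b::euclidean_space) \<Rightarrow> bool" where
  "piecewise_linear_on S f \<longleftrightarrow> continuous_on S f \<and>
     (\<exists>\<T>. simplicial_complex \<T> \<and> \<Union>\<T> = S \<and>
        (\<forall>T\<in>\<T>. \<exists>L c. linear L \<and> (\<forall>x\<in>T. f x = L x + c)))"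

definition multiple_points :: "('a \<Rightarrow> 'b) \<Rightarrow> 'a set \<Rightarrow> 'b set" where
  "multiple_points f S = {p. \<exists>x\<in>S. \<exists>y\<in>S. x \<noteq> y \<and> f x = p \<and> f y = p}"

definition double_points :: "('a \<Rightarrow> 'b) \<Rightarrow> 'a set \<Rightarrow> 'b set" where
  "double_points f S = {p. card (S \<inter> f -` {p}) = 2}"

definition neighbourhood_in :: "'a::topological_space set \<Rightarrow> 'a \<Rightarrow> 'a set \<Rightarrow> bool" where
  "neighbourhood_in S x A \<longleftrightarrow>
     A \<subseteq> S \<and> (\<exists>U. openin (top_of_set S) U \<and> x \<in> U \<and> U \<subseteq> A)"

text \<open>Transversality in the piecewise linear sense: some piecewise linear chart \<open>\<psi>\<close> of the plane,
  defined on the square with corners \<open>(\<plusminus>1,\<plusminus>1)\<close>, turns the two branches of \<open>f\<close> into the two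
  coordinate axes. A branch is thus allowed to bend at the crossing. By invariance of domain
  the image of \<open>\<psi>\<close> is a neighbourhood of the double point.\<close>

definition transversal_at ::
  "('a::topological_space \<Rightarrow> real ^ 2) \<Rightarrow> 'a set \<Rightarrow> 'a \<Rightarrow> 'a \<Rightarrow> bool" where
  "transversal_at f S x y \<longleftrightarrow>
     (\<exists>A B \<psi> :: real ^ 2 \<Rightarrow> real ^ 2.
        neighbourhood_in S x A \<and> neighbourhood_in S y B \<and>
        piecewise_linear_on (cbox (-1) 1) \<psi> \<and> inj_on \<psi> (cbox (-1) 1) \<and>
        \<psi> 0 = f x \<and> \<psi> 0 = f y \<and>
        f ` A = \<psi> ` {z \<in> cbox (-1) 1. z $ 2 = 0} \<and>
        f ` B = \<psi> ` {z \<in> cbox (-1) 1. z $ 1 = 0})"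

text \<open>Only the values of \<open>f\<close> on the realization of \<open>G\<close> matter.\<close>

definition generic_immersion :: "'v::finite graph \<Rightarrow> (real ^ 'v \<Rightarrow> real ^ 2) \<Rightarrow> bool" where
  "generic_immersion G f \<longleftrightarrow>
     piecewise_linear_on (realization G) f \<and>
     finite (multiple_points f (realization G)) \<and>
     (\<forall>p\<in>multiple_points f (realization G). \<exists>x y. x \<noteq> y \<and>
        realization G \<inter> f -` {p} = {x, y} \<and>
        x \<in> edge_interiors G \<and> y \<in> edge_interiors G \<and>
        transversal_at f (realization G) x y)"


section \<open>Oriented circles\<close>

text \<open>An orientation of a topological circle \<open>S\<close> is given by a homeomorphism \<open>\<phi>\<close> from the unit
  circle in the complex plane, with its counterclockwise orientation, onto \<open>S\<close>. Two such
  homeomorphisms give the same orientation if they differ by a self-map of the unit circle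
  of degree 1. In particular \<open>id\<close> gives the counterclockwise orientation of the unit circle
  itself.\<close>

definition orientation_of :: "(complex \<Rightarrow> 'a::topological_space) \<Rightarrow> 'a set \<Rightarrow> bool" where
  "orientation_of \<phi> S \<longleftrightarrow> (\<exists>\<phi>'. homeomorphism (sphere 0 1) S \<phi> \<phi>')"

text \<open>The degree of the self-map of the unit circle corresponding to \<open>h\<close> is the winding number of
  the image of the standard counterclockwise loop; it is 1 or -1 as \<open>h\<close> is a homeomorphism.\<close>

definition orientation_preserving_homeomorphism ::
  "(complex \<Rightarrow> 'a::topological_space) \<Rightarrow> 'a set \<Rightarrow>
   (complex \<Rightarrow> 'b::topological_space) \<Rightarrow> 'b set \<Rightarrow> ('a \<Rightarrow> 'b) \<Rightarrow> bool" where
  "orientation_preserving_homeomorphism \<phi>\<^sub>1 S\<^sub>1 \<phi>\<^sub>2 S\<^sub>2 h \<longleftrightarrow>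
     (\<exists>h'. homeomorphism S\<^sub>1 S\<^sub>2 h h') \<and>
     winding_number (inv_into (sphere 0 1) \<phi>\<^sub>2 \<circ> h \<circ> \<phi>\<^sub>1 \<circ> circlepath 0 1) 0 = 1"


section \<open>Chord diagrams\<close>

definition n_chord_diagram :: "nat \<Rightarrow> 'a set \<Rightarrow> 'a set set \<Rightarrow> bool" where
  "n_chord_diagram n S \<C> \<longleftrightarrow>
     (\<exists>P. P \<subseteq> S \<and> finite P \<and> card P = 2 * n \<and>
        partition_on P \<C> \<and> card \<C> = n \<and> (\<forall>c\<in>\<C>. card c = 2))"

definition sub_chord_diagram :: "'a set \<Rightarrow> 'a set set \<Rightarrow> 'a set set \<Rightarrow> bool" where
  "sub_chord_diagram S \<D> \<C> \<longleftrightarrow> (\<exists>m. n_chord_diagram m S \<D>) \<and> \<D> \<subseteq> \<C>"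

definition equivalent_chord_diagrams ::
  "(complex \<Rightarrow> 'a::topological_space) \<Rightarrow> 'a set \<Rightarrow> 'a set set \<Rightarrow>
   (complex \<Rightarrow> 'b::topological_space) \<Rightarrow> 'b set \<Rightarrow> 'b set set \<Rightarrow> bool" where
  "equivalent_chord_diagrams \<phi>\<^sub>1 S\<^sub>1 \<C>\<^sub>1 \<phi>\<^sub>2 S\<^sub>2 \<C>\<^sub>2 \<longleftrightarrow>
     (\<exists>n. n_chord_diagram n S\<^sub>1 \<C>\<^sub>1 \<and> n_chord_diagram n S\<^sub>2 \<C>\<^sub>2) \<and>
     (\<exists>h. orientation_preserving_homeomorphism \<phi>\<^sub>1 S\<^sub>1 \<phi>\<^sub>2 S\<^sub>2 h \<and> (\<forall>c\<in>\<C>\<^sub>1. h ` c \<in> \<C>\<^sub>2))"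

definition chord_diagram_of_map :: "('a \<Rightarrow> 'b) \<Rightarrow> 'a set \<Rightarrow> 'a set set" where
  "chord_diagram_of_map f S = {S \<inter> f -` {p} | p. p \<in> double_points f S}"

end

theory Submission
  imports Defs
begin

text \<open>If two vertex-disjoint edges of a cycle cross, the two preimages of the crossing form a chord whose
endpoints lie on these two edges. Suppose that \<open>n\<close> pairs of crossing edges were given, with all
\<open>4n\<close> end vertices distinct. A Hamiltonian cycle may run through these \<open>2n\<close> edges in any cyclic
order, joining consecutive ones by further edges of the complete graph, so every \<open>n\<close>-chord diagram
would appear. Such pairs need not exist: among any five vertices there is a crossing of
two disjoint edges (\<open>crossing_in_five_vertices\<close>), so \<open>n - 1\<close> disjoint crossing quadruples can be
chosen greedily, but the four vertices that remain may span a plane graph.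

The remedy is to add to these four vertices one vertex \<open>b\<close> of a quadruple chosen before, where \<open>ab\<close>
crosses \<open>cd\<close>. The five vertices again contain a crossing. If it avoids \<open>b\<close>, all quadruples are
disjoint. Otherwise an edge \<open>br\<close> crosses an edge disjoint from everything else, and the path \<open>a b r\<close>
carries one endpoint of each of the two chords, as neighbours on the cycle. This is harmless,
because for \<open>n \<ge> 2\<close> the given diagram has two consecutive endpoints that belong to
different chords, and these two chords are realized by the two crossings that share \<open>b\<close>. The one
vertex left over is inserted between two of the prescribed edges
(\<open>crossings_covering_almost_all_vertices\<close>, \<open>vertex_sequence_through_edges\<close>).

The crossing among five vertices is the nonplanarity of \<open>K\<^sub>5\<close> in the strong form that ignores
intersections of adjacent edges (\<open>disjoint_segments_among_five_points_meet\<close>). If \<open>F x \<noteq> F y\<close> whenever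
\<open>x\<close> and \<open>y\<close> lie on disjoint edges, then \<open>F x - F y\<close> has a continuous logarithm on the product of any
two disjoint edges, so its total increment around the boundary of this square vanishes. Measured in
half turns this is one integer equation for each of the 15 pairs of disjoint edges, and their sum is
contradictory modulo 2.

Finally, the circle is mapped onto the realization of the cycle by a homeomorphism that takes the
endpoints of the given chords to the chosen preimages of crossings
(\<open>cyclic_graph_through_points\<close>). As this homeomorphism also serves to orient the cycle, its inverse is
an orientation preserving equivalence of the diagrams (\<open>transported_chord_diagram\<close>).\<close>


section \<open>Five points in the plane\<close>

text \<open>Both sides are increments of logarithms of functions that differ by a constant factor, so \<open>g - h\<close>
takes values in a coset of the discrete group of multiples of \<open>2\<pi>\<i>\<close> and is constant on the segment.\<close>
lemma log_increment_unique:
  fixes g h :: "'a::real_normed_vector \<Rightarrow> complex"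
  assumes "continuous_on (closed_segment a b) g" "continuous_on (closed_segment a b) h"
    and "\<And>x. x \<in> closed_segment a b \<Longrightarrow> exp (g x) = c * exp (h x)"
  shows "g b - g a = h b - h a"
proof -
  have "c \<noteq> 0"
    using assms(3)[of a] by auto
  have *: "exp (g x - h x) = c" if "x \<in> closed_segment a b" for x
    by (simp add: exp_diff assms(3)[OF that])
  have "(\<lambda>x. g x - h x) constant_on closed_segment a b"
  proof (rule continuous_discrete_range_constant)
    show "continuous_on (closed_segment a b) (\<lambda>x. g x - h x)"
      using assms by (intro continuous_intros)
    fix x assume x: "x \<in> closed_segment a b"
    have "2*pi \<le> cmod (g y - h y - (g x - h x))"
      if y: "y \<in> closed_segment a b" and ne: "g y - h y \<noteq> g x - h x" for y
    proof -
      have "exp (g y - h y) = exp (g x - h x)"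
        using *[OF x] *[OF y] by simp
      then obtain n :: int where n: "g y - h y = g x - h x + (of_int (2 * n) * pi) * \<i>"
        unfolding exp_eq by blast
      with ne have "n \<noteq> 0" by auto
      then have "1 \<le> \<bar>real_of_int n\<bar>" by linarith
      then have "2 * pi \<le> 2 * \<bar>real_of_int n\<bar> * pi" by simp
      then show ?thesis by (simp add: n norm_mult)
    qed
    then show "\<exists>e>0. \<forall>y. y \<in> closed_segment a b \<and> g y - h y \<noteq> g x - h x \<longrightarrow>
        e \<le> cmod (g y - h y - (g x - h x))"
      by (intro exI[of _ "2*pi"]) auto
  qed simp
  then obtain d where "g x - h x = d" if "x \<in> closed_segment a b" for x
    unfolding constant_on_def by blast
  from this[of a] this[of b] have "g a - h a = g b - h b"
    by simp
  then show ?thesis by (simp add: algebra_simps)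
qed

text \<open>The imaginary part is the angle swept by the vector from \<open>F c\<close> to \<open>F x\<close> while \<open>x\<close> runs from \<open>a\<close>
to \<open>b\<close>.\<close>
definition log_increment :: "('a::real_normed_vector \<Rightarrow> complex) \<Rightarrow> 'a \<Rightarrow> 'a \<Rightarrow> 'a \<Rightarrow> complex" where
  "log_increment F c a b = (THE d. \<exists>g. continuous_on (closed_segment a b) g \<and>
     (\<forall>x\<in>closed_segment a b. F x - F c = exp (g x)) \<and> d = g b - g a)"

text \<open>The factor \<open>s\<close> is there for \<open>s = -1\<close>: the increment may also be read off from a logarithm of
\<open>F c - F x\<close>.\<close>
lemma log_increment_eq:
  assumes "continuous_on (closed_segment a b) g"
    and "\<And>x. x \<in> closed_segment a b \<Longrightarrow> F x - F c = s * exp (g x)"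
    and "s \<noteq> 0"
  shows "log_increment F c a b = g b - g a"
proof -
  obtain l where l: "exp l = s" using assms(3) by (metis exp_Ln)
  define g' where "g' = (\<lambda>x. l + g x)"
  have g': "continuous_on (closed_segment a b) g'"
     "\<And>x. x \<in> closed_segment a b \<Longrightarrow> F x - F c = exp (g' x)"
    using assms l by (auto simp: g'_def exp_add intro!: continuous_intros)
  have "log_increment F c a b = g' b - g' a"
    unfolding log_increment_def
  proof (rule the_equality)
    show "\<exists>h. continuous_on (closed_segment a b) h \<and>
      (\<forall>x\<in>closed_segment a b. F x - F c = exp (h x)) \<and> g' b - g' a = h b - h a"
      using g' by blast
    fix d assume "\<exists>h. continuous_on (closed_segment a b) h \<and>
      (\<forall>x\<in>closed_segment a b. F x - F c = exp (h x)) \<and> d = h b - h a"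
    then obtain h where h: "continuous_on (closed_segment a b) h"
      "\<And>x. x \<in> closed_segment a b \<Longrightarrow> F x - F c = exp (h x)" "d = h b - h a" by blast
    have "h b - h a = g' b - g' a"
      using h g' by (intro log_increment_unique[where c = 1]) auto
    then show "d = g' b - g' a" using h by simp
  qed
  then show ?thesis by (simp add: g'_def)
qed

text \<open>A logarithm of \<open>F x - F y\<close> exists on the whole product of the two segments, which is contractible. The
two sides are its increments along the two ways from the corner \<open>(a, c)\<close> to the opposite corner
\<open>(b, d)\<close>.\<close>
lemma log_increment_square:
  fixes F :: "'a::real_normed_vector \<Rightarrow> complex"
  assumes "continuous_on (closed_segment a b) F" "continuous_on (closed_segment c d) F"
    and disj: "\<And>x y. x \<in> closed_segment a b \<Longrightarrow> y \<in> closed_segment c d \<Longrightarrow> F x \<noteq> F y"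
  shows "log_increment F c a b + log_increment F b c d = log_increment F a c d + log_increment F d a b"
proof -
  let ?S = "closed_segment a b \<times> closed_segment c d"
  have "continuous_on ?S (\<lambda>(x, y). F x - F y)"
    unfolding case_prod_beta
    by (intro continuous_intros continuous_on_compose2[OF assms(1)] continuous_on_compose2[OF assms(2)]) auto
  moreover have "contractible ?S"
    by (intro convex_imp_contractible convex_Times) auto
  ultimately obtain g where g: "continuous_on ?S g"
    "\<And>z. z \<in> ?S \<Longrightarrow> (\<lambda>(x, y). F x - F y) z = exp (g z)"
    using disj by (rule_tac continuous_logarithm_on_contractible[of ?S "\<lambda>(x, y). F x - F y"]) auto
  have 1: "log_increment F y a b = g (b, y) - g (a, y)" if "y \<in> closed_segment c d" for y
  proof (rule log_increment_eq[where s = 1 and g = "\<lambda>x. g (x, y)"])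
    show "continuous_on (closed_segment a b) (\<lambda>x. g (x, y))"
      using that by (intro continuous_on_compose2[OF g(1)] continuous_intros) auto
    show "F x - F y = 1 * exp (g (x, y))" if "x \<in> closed_segment a b" for x
      using that g(2)[of "(x, y)"] \<open>y \<in> closed_segment c d\<close> by simp
  qed auto
  have 2: "log_increment F x c d = g (x, d) - g (x, c)" if "x \<in> closed_segment a b" for x
  proof (rule log_increment_eq[where s = "-1" and g = "\<lambda>y. g (x, y)"])
    show "continuous_on (closed_segment c d) (\<lambda>y. g (x, y))"
      using that by (intro continuous_on_compose2[OF g(1)] continuous_intros) auto
    show "F y - F x = -1 * exp (g (x, y))" if "y \<in> closed_segment c d" for y
    proof -
      have "F x - F y = exp (g (x, y))"
        using that g(2)[of "(x, y)"] \<open>x \<in> closed_segment a b\<close> by simp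
      then show ?thesis by (metis minus_diff_eq mult_minus1)
    qed
  qed auto
  show ?thesis by (simp add: 1 2)
qed

text \<open>Logarithms \<open>u\<close>, \<open>v\<close> of the end values, chosen independently of the edge, predict the increment up to
the number \<open>k\<close> of full turns.\<close>
lemma log_increment_up_to_turns:
  fixes F :: "'a::real_normed_vector \<Rightarrow> complex"
  assumes "continuous_on (closed_segment a b) F"
    and "\<And>x. x \<in> closed_segment a b \<Longrightarrow> F x \<noteq> F c"
    and "exp u = F a - F c" "exp v = F b - F c"
  shows "\<exists>k::int. log_increment F c a b = v - u + 2 * pi * of_int k * \<i>"
proof -
  obtain g where g: "continuous_on (closed_segment a b) g"
    "\<And>z. z \<in> closed_segment a b \<Longrightarrow> F z - F c = exp (g z)"
    using assms
    by (rule_tac continuous_logarithm_on_contractible[of "closed_segment a b" "\<lambda>z. F z - F c"])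
       (auto intro!: continuous_intros convex_imp_contractible)
  have eq: "log_increment F c a b = g b - g a"
    using g by (intro log_increment_eq[where s = 1]) auto
  have "exp (g b - g a) = exp (v - u)"
    using g(2)[of a] g(2)[of b] assms(3,4) by (simp add: exp_diff)
  then obtain k :: int where "g b - g a = v - u + (of_int (2 * k) * pi) * \<i>"
    unfolding exp_eq by blast
  then show ?thesis using eq by (intro exI[of _ k]) (simp add: mult_ac)
qed

text \<open>Fix logarithms \<open>u i k\<close> of \<open>F (p i) - F (p k)\<close> such that \<open>u i k\<close> and \<open>u k i\<close> differ by exactly \<open>\<pi>\<i>\<close>,
and let \<open>m k i j\<close> be the number of turns that the edge \<open>ij\<close> makes about the vertex \<open>k\<close> relative to
them. The increments around the boundary of the square of two disjoint edges \<open>ij\<close> and \<open>kl\<close> cancel,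
which expresses \<open>m k i j + m j k l - m i k l - m l i j\<close> as a number that is odd
precisely if the pairs \<open>i, j\<close> and \<open>k, l\<close> interleave in the order of indices. Among the 15 pairs of disjoint edges of
\<open>K\<^sub>5\<close> this happens for 5, one for each choice of four points. On the other hand, \<open>ij\<close> and \<open>k\<close> belong to
exactly two pairs \<open>ij\<close>, \<open>kl\<close>, so every turn number occurs twice in the sum of the 15 equations, and the sum
is even.\<close>
lemma disjoint_segments_among_five_points_meet:
  fixes F :: "'a::real_normed_vector \<Rightarrow> complex" and p :: "nat \<Rightarrow> 'a"
  assumes cont: "\<And>i j. i < 5 \<Longrightarrow> j < 5 \<Longrightarrow> continuous_on (closed_segment (p i) (p j)) F"
  shows "\<exists>i<5. \<exists>j<5. \<exists>k<5. \<exists>l<5. distinct [i,j,k,l] \<and>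
    (\<exists>x\<in>closed_segment (p i) (p j). \<exists>y\<in>closed_segment (p k) (p l). F x = F y)"
proof (rule ccontr)
  assume neg: "\<not> ?thesis"
  have apart: "F x \<noteq> F y" if "i < 5" "j < 5" "k < 5" "l < 5" "distinct [i,j,k,l]"
    "x \<in> closed_segment (p i) (p j)" "y \<in> closed_segment (p k) (p l)" for i j k l x y
    using neg that by blast
  \<comment> \<open>There are enough points to extend two vertices, or an edge and a vertex, to two disjoint edges,
    so \<open>apart\<close> applies to them as well.\<close>
  have fifth: "\<exists>l<5. l \<notin> {i, j, k}" for i j k :: nat
  proof (rule ccontr)
    assume "\<not> ?thesis"
    then have "{..<5} \<subseteq> {i, j, k}" by auto
    then have "card {..<5::nat} \<le> card {i, j, k}" by (intro card_mono) auto
    also have "card {i, j, k} \<le> 3" by (simp add: card_insert_if)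
    finally show False by simp
  qed
  define u where "u i k = (if i < k then Ln (F (p k) - F (p i)) + pi * \<i> else Ln (F (p i) - F (p k)))" for i k
  have u: "exp (u i k) = F (p i) - F (p k)" if "i < 5" "k < 5" "i \<noteq> k" for i k
  proof -
    obtain j where "j < 5" "j \<notin> {i, k}"
      using fifth[of i k k] by auto
    moreover obtain l where "l < 5" "l \<notin> {i, j, k}"
      using fifth by blast
    ultimately have "j < 5" "l < 5" "distinct [i,j,k,l]"
      using that by auto
    then have "F (p i) \<noteq> F (p k)"
      using that by (intro apart[of i j k l]) auto
    then show ?thesis
      by (simp add: u_def exp_add)
  qed
  have defect: "\<exists>m::int. log_increment F (p k) (p i) (p j) = u j k - u i k + 2 * pi * of_int m * \<i>"
    if "i < 5" "j < 5" "k < 5" "distinct [i,j,k]" for i j k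
  proof -
    obtain l where "l < 5" "l \<notin> {i, j, k}"
      using fifth by blast
    then have "F x \<noteq> F (p k)" if "x \<in> closed_segment (p i) (p j)" for x
      using that \<open>i < 5\<close> \<open>j < 5\<close> \<open>k < 5\<close> \<open>distinct [i,j,k]\<close> by (intro apart[of i j k l]) auto
    then show ?thesis
      using that by (intro log_increment_up_to_turns cont) (simp_all add: u)
  qed
  define m where "m k i j = (SOME m::int. log_increment F (p k) (p i) (p j)
      = u j k - u i k + 2 * pi * of_int m * \<i>)" for k i j
  have m: "log_increment F (p k) (p i) (p j) = u j k - u i k + 2 * pi * of_int (m k i j) * \<i>"
    if "i < 5" "j < 5" "k < 5" "distinct [i,j,k]" for i j k
    using someI_ex[OF defect[OF that]] unfolding m_def .
  define s where "s i k = (if i < k then 1 else 0 :: int)" for i k :: nat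
  have us: "u i k = u k i + of_int (s i k - s k i) * pi * \<i>" if "i \<noteq> k" for i k
    using that by (cases "i < k") (simp_all add: u_def s_def)
  have eqn: "2 * (m k i j + m j k l - m i k l - m l i j) =
      (s k j - s j k) + (s l i - s i l) - (s k i - s i k) - (s l j - s j l)"
    if "i < 5" "j < 5" "k < 5" "l < 5" "distinct [i,j,k,l]" for i j k l
  proof -
    have "log_increment F (p k) (p i) (p j) + log_increment F (p j) (p k) (p l)
       = log_increment F (p i) (p k) (p l) + log_increment F (p l) (p i) (p j)"
      using that by (intro log_increment_square cont apart[of i j k l]) auto
    moreover have "pi * \<i> * of_int (2 * (m k i j + m j k l - m i k l - m l i j) -
      ((s k j - s j k) + (s l i - s i l) - (s k i - s i k) - (s l j - s j l))) =
      (log_increment F (p k) (p i) (p j) + log_increment F (p j) (p k) (p l))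
       - (log_increment F (p i) (p k) (p l) + log_increment F (p l) (p i) (p j))"
      using that by (simp add: m us[of k j] us[of l i] us[of k i] us[of l j]) (simp add: algebra_simps)
    ultimately have "pi * \<i> * of_int (2 * (m k i j + m j k l - m i k l - m l i j) -
      ((s k j - s j k) + (s l i - s i l) - (s k i - s i k) - (s l j - s j l))) = 0"
      by simp
    then have "of_int (2 * (m k i j + m j k l - m i k l - m l i j) -
      ((s k j - s j k) + (s l i - s i l) - (s k i - s i k) - (s l j - s j l))) = (0::complex)"
      by simp
    then show ?thesis by (simp only: of_int_eq_0_iff)
  qed
  \<comment> \<open>The sum of the 15 equations. Terms that occur with opposite signs have cancelled, the others
    occur with coefficient 4 because each equation is stated with a factor 2. The right-hand side is
    twice the number 5 of interleaved pairs.\<close>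
  have "4 * (m 2 0 1 - m 0 2 3 + m 1 0 2 + m 2 1 3 - m 0 1 3 + m 1 0 3 + m 3 1 2 - m 0 1 2 - m 0 2 4 - m 4 0 1
      + m 2 1 4 - m 0 1 4 - m 4 0 2 + m 1 0 4 - m 0 3 4 - m 4 0 3 - m 3 0 4 + m 2 3 4 + m 3 2 4 + m 4 2 3) = 10"
    using eqn[of 0 1 2 3] eqn[of 0 2 1 3] eqn[of 0 3 1 2]
      eqn[of 0 1 2 4] eqn[of 0 2 1 4] eqn[of 0 4 1 2]
      eqn[of 0 1 3 4] eqn[of 0 3 1 4] eqn[of 0 4 1 3]
      eqn[of 0 2 3 4] eqn[of 0 3 2 4] eqn[of 0 4 2 3]
      eqn[of 1 2 3 4] eqn[of 1 3 2 4] eqn[of 1 4 2 3]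
    by (simp add: s_def)
  moreover have "4 * z \<noteq> 10" for z :: int
    by presburger
  ultimately show False
    by blast
qed

section \<open>Crossings in a generic immersion of a complete graph\<close>
lemma inj_vertex_point: "inj vertex_point"
  by (auto simp: inj_def vertex_point_def axis_eq_axis)

lemma vertex_point_eq_iff [simp]: "vertex_point a = vertex_point b \<longleftrightarrow> a = b"
  using inj_vertex_point by (auto dest: injD)

lemma edge_segment_doubleton: "edge_segment {a, b} = closed_segment (vertex_point a) (vertex_point b)"
  by (simp add: edge_segment_def segment_convex_hull)

lemma vertex_point_nth: "(vertex_point a :: real ^ 'v::finite) $ w = of_bool (w = a)"
  by (simp add: vertex_point_def axis_def)

text \<open>The coordinates of a point of an edge show which edge it lies on; disjoint edges are thus disjoint as
segments.\<close>
lemma closed_segment_vertex_point_nth: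
  fixes x :: "real ^ 'v::finite"
  assumes "x \<in> closed_segment (vertex_point a) (vertex_point b)" "a \<noteq> b"
  shows "x $ a + x $ b = 1" and "w \<notin> {a, b} \<Longrightarrow> x $ w = 0"
  using assms by (auto simp: in_segment vertex_point_nth)

text \<open>A vertex has a coordinate 1, so no vertex lies in the interior of an edge.\<close>
lemma open_segment_vertex_point_nth_less:
  fixes x :: "real ^ 'v::finite"
  assumes "x \<in> open_segment (vertex_point a) (vertex_point b)"
  shows "x $ w < 1"
  using assms by (auto simp: in_segment vertex_point_nth)

lemma edge_interiors_complete_graph:
  "edge_interiors (complete_graph :: 'v::finite graph) =
     (\<Union>(a, b)\<in>{(a, b). a \<noteq> b}. open_segment (vertex_point a) (vertex_point b))"
proof -
  have "rel_interior (edge_segment {a, b}) = open_segment (vertex_point a) (vertex_point b)"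
    if "a \<noteq> b" for a b :: 'v
    using that by (simp add: edge_segment_doubleton rel_interior_closed_segment)
  then show ?thesis
    by (auto simp: edge_interiors_def complete_graph_def edges_def card_2_iff split: prod.splits)
qed

lemma segment_subset_realization_complete:
  "closed_segment (vertex_point a) (vertex_point b) \<subseteq> realization complete_graph"
proof (cases "a = b")
  case False
  then have "{a, b} \<in> edges complete_graph"
    by (simp add: complete_graph_def edges_def)
  then show ?thesis
    by (auto simp: realization_def edge_segment_doubleton[symmetric])
qed (auto simp: realization_def complete_graph_def verts_def)

text \<open>The whole fibre over the double point, taken in the complete graph, is prescribed. A subgraph that contains the
edges \<open>ab\<close> and \<open>cd\<close> therefore has the same fibre, and \<open>{x, y}\<close> is a chord of its diagram.\<close>
definition crosses :: "(real ^ 'v \<Rightarrow> real ^ 2) \<Rightarrow> 'v::finite \<Rightarrow> 'v \<Rightarrow> 'v \<Rightarrow> 'v \<Rightarrow> bool" where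
  "crosses f a b c d \<longleftrightarrow> distinct [a, b, c, d] \<and>
     (\<exists>x \<in> open_segment (vertex_point a) (vertex_point b).
      \<exists>y \<in> open_segment (vertex_point c) (vertex_point d).
        realization complete_graph \<inter> f -` {f x} = {x, y})"

lemma crosses_sym:
  assumes "crosses f a b c d"
  shows "crosses f b a c d" and "crosses f c d a b"
proof -
  show "crosses f b a c d"
    using assms by (auto simp: crosses_def open_segment_commute)
  obtain x y where *: "distinct [a, b, c, d]" "x \<in> open_segment (vertex_point a) (vertex_point b)"
     "y \<in> open_segment (vertex_point c) (vertex_point d)"
     "realization complete_graph \<inter> f -` {f x} = {x, y}"
    using assms unfolding crosses_def by blast
  then have "f y = f x" by auto
  then have "realization complete_graph \<inter> f -` {f y} = {y, x}"
    using * by (metis insert_commute)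
  with * show "crosses f c d a b"
    unfolding crosses_def by (metis distinct_length_2_or_more distinct_singleton)
qed

text \<open>The preceding section gives points of two disjoint edges with the same image. Genericity makes this
image a double point with both preimages inside edges.\<close>
lemma crossing_in_five_vertices:
  fixes f :: "real ^ 'v::finite \<Rightarrow> real ^ 2"
  assumes gen: "generic_immersion complete_graph f" and "card S = 5"
  shows "\<exists>a b c d. {a, b, c, d} \<subseteq> S \<and> crosses f a b c d"
proof -
  let ?R = "realization (complete_graph :: 'v graph)"
  define F where "F x = complex_of_real (f x $ 1) + \<i> * complex_of_real (f x $ 2)" for x :: "real ^ 'v"
  have F_eq: "F x = F y \<longleftrightarrow> f x = f y" for x y
    by (simp add: F_def complex_eq_iff vec_eq_iff forall_2)
  have cont: "continuous_on ?R F"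
    using gen unfolding F_def generic_immersion_def piecewise_linear_on_def
    by (auto intro!: continuous_intros)
  obtain p where p: "bij_betw p {..<5::nat} S"
    using ex_bij_betw_nat_finite[of S] \<open>card S = 5\<close>
    by (metis atLeast0LessThan card.infinite zero_neq_numeral)
  have "\<exists>i<5. \<exists>j<5. \<exists>k<5. \<exists>l<5. distinct [i,j,k,l] \<and>
    (\<exists>x\<in>closed_segment (vertex_point (p i)) (vertex_point (p j)).
     \<exists>y\<in>closed_segment (vertex_point (p k)) (vertex_point (p l)). F x = F y)"
    by (rule disjoint_segments_among_five_points_meet[of "\<lambda>i. vertex_point (p i)" F])
       (rule continuous_on_subset[OF cont segment_subset_realization_complete])
  then obtain i j k l x y where ijkl: "i<5" "j<5" "k<5" "l<5" "distinct [i,j,k,l]" and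
    x: "x\<in>closed_segment (vertex_point (p i)) (vertex_point (p j))" and
    y: "y\<in>closed_segment (vertex_point (p k)) (vertex_point (p l))" and "F x = F y"
    by blast
  have S: "{p i, p j, p k, p l} \<subseteq> S"
    using p ijkl by (auto simp: bij_betw_def)
  have dist: "distinct [p i, p j, p k, p l]"
    using p ijkl unfolding bij_betw_def inj_on_def by (auto simp: lessThan_iff)
  have "x \<noteq> y"
    using closed_segment_vertex_point_nth[OF x] closed_segment_vertex_point_nth[OF y] dist
    by force
  have xy: "f x = f y" "x \<in> ?R" "y \<in> ?R"
    using \<open>F x = F y\<close> F_eq x y segment_subset_realization_complete by blast+
  then have "f x \<in> multiple_points f ?R"
    using \<open>x \<noteq> y\<close> by (auto simp: multiple_points_def)
  then obtain x' y' where x'y': "?R \<inter> f -` {f x} = {x', y'}"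
     "x' \<in> edge_interiors complete_graph" "y' \<in> edge_interiors complete_graph"
    using gen unfolding generic_immersion_def by metis
  moreover have "x \<in> ?R \<inter> f -` {f x}" "y \<in> ?R \<inter> f -` {f x}"
    using xy by auto
  ultimately have xy_eq: "?R \<inter> f -` {f x} = {x, y}" and
    int: "x \<in> edge_interiors complete_graph" "y \<in> edge_interiors complete_graph"
    using \<open>x \<noteq> y\<close> by auto
  have interior: "z \<in> open_segment (vertex_point a) (vertex_point b)"
    if z: "z \<in> closed_segment (vertex_point a) (vertex_point b)"
      and int: "z \<in> edge_interiors complete_graph" for z :: "real ^ 'v" and a b :: 'v
  proof (rule ccontr)
    assume "\<not> ?thesis"
    then have "z = vertex_point a \<or> z = vertex_point b"
      using z by (auto simp: open_segment_def)
    then obtain w :: 'v where "z $ w = 1" by (auto simp: vertex_point_nth)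
    moreover obtain a' b' :: 'v where "z \<in> open_segment (vertex_point a') (vertex_point b')"
      using int by (auto simp: edge_interiors_complete_graph)
    ultimately show False
      using open_segment_vertex_point_nth_less[of z a' b' w] by simp
  qed
  have "crosses f (p i) (p j) (p k) (p l)"
    unfolding crosses_def using dist xy_eq interior[OF x int(1)] interior[OF y int(2)] by blast
  then show ?thesis using S by blast
qed

section \<open>Homeomorphisms from the circle\<close>

text \<open>The piecewise linear function through the points \<open>(t i, s i)\<close>, continued beyond the last one with positive
slope; the induction adds one linear piece.\<close>
lemma strict_mono_interpolation:
  fixes t s :: "nat \<Rightarrow> real"
  assumes "\<And>i. i < m \<Longrightarrow> t i < t (Suc i)" "\<And>i. i < m \<Longrightarrow> s i < s (Suc i)"
  shows "\<exists>u. continuous_on UNIV u \<and> strict_mono u \<and> (\<forall>i\<le>m. u (t i) = s i)"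
  using assms
proof (induction m)
  case 0
  have "continuous_on UNIV (\<lambda>x. x - t 0 + s 0) \<and> strict_mono (\<lambda>x. x - t 0 + s 0)"
    by (auto intro!: continuous_intros strict_monoI)
  then show ?case by (intro exI[of _ "\<lambda>x. x - t 0 + s 0"]) simp
next
  case (Suc m)
  then obtain u where u: "continuous_on UNIV u" "strict_mono u" "\<And>i. i \<le> m \<Longrightarrow> u (t i) = s i"
    by (meson less_Suc_eq)
  define q where "q = (s (Suc m) - s m) / (t (Suc m) - t m)"
  have q: "q > 0" using Suc.prems[of m] by (simp add: q_def)
  define w where "w x = (if x \<le> t m then u x else s m + q * (x - t m))" for x
  have le: "t i \<le> t m" if "i \<le> m" for i
    using that
  proof (induction rule: inc_induct)
    case (step i)
    then show ?case using Suc.prems(1)[of i] by simp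
  qed simp
  have "continuous_on UNIV w"
  proof -
    have "continuous_on ({..t m} \<union> {t m..}) w"
      unfolding w_def using u
      by (intro continuous_on_cases) (auto intro!: continuous_intros intro: continuous_on_subset)
    moreover have "{..t m} \<union> {t m..} = UNIV" by auto
    ultimately show ?thesis by simp
  qed
  moreover have "strict_mono w"
  proof (rule strict_monoI)
    fix x y :: real assume "x < y"
    have "u x \<le> s m" if "x \<le> t m"
      using that u(2) u(3)[of m] by (metis strict_mono_less_eq order_refl)
    then show "w x < w y"
      using \<open>x < y\<close> q u(2) by (auto simp: w_def strict_mono_less intro: le_less_trans add_pos_pos)
  qed
  moreover have "w (t i) = s i" if "i \<le> Suc m" for i
  proof (cases "i = Suc m")
    case True
    then show ?thesis using Suc.prems(1)[of m] by (simp add: w_def q_def)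
  next
    case False
    then show ?thesis using that u(3) le by (simp add: w_def)
  qed
  ultimately show ?case by blast
qed

text \<open>The base point \<open>w\<close> of the circle is left free, so that finitely many given points
can be kept away from the parameter \<open>0\<close>, where the loop closes up.\<close>
lemma homeomorphism_circle_simple_loop:
  fixes g :: "real \<Rightarrow> 'a::t2_space" and w :: complex
  assumes g: "simple_path g" "pathfinish g = pathstart g" and w: "cmod w = 1"
  shows "\<exists>\<phi> \<phi>'. homeomorphism (sphere 0 1) (path_image g) \<phi> \<phi>' \<and>
           (\<forall>x. 0 \<le> x \<and> x < 1 \<longrightarrow> \<phi> (w * exp (2 * pi * x * \<i>)) = g x)"
proof -
  have w0: "w \<noteq> 0" using w by auto
  define a where "a z = Arg2pi (z / w) / (2 * pi)" for z
  have a_bounds: "0 \<le> a z" "a z < 1" for z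
    using Arg2pi_ge_0[of "z / w"] Arg2pi_lt_2pi[of "z / w"] by (auto simp: a_def)
  have a_inv: "w * exp (2 * pi * a z * \<i>) = z" if "cmod z = 1" for z
    using Arg2pi_eq[of "z / w"] w w0 that by (simp add: a_def norm_divide field_simps)
  have a_exp: "a (w * exp (2 * pi * x * \<i>)) = x" if "0 \<le> x" "x < 1" for x
    using that w0 by (simp add: a_def Arg2pi_exp)
  have g_eq: "x = y" if "g x = g y" "0 \<le> x" "x < 1" "0 \<le> y" "y < 1" for x y
    using g(1) that unfolding simple_path_def loop_free_def by force
  have "homotopic_with_canon (\<lambda>h. True) (sphere 0 1) (path_image g)
      (g \<circ> (\<lambda>z. Arg2pi z / (2*pi))) (g \<circ> (\<lambda>z. Arg2pi z / (2*pi)))"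
    using g by (intro homotopic_loops_imp_homotopic_circlemaps)
      (simp add: homotopic_loops_refl simple_path_imp_path)
  then have "continuous_on (sphere 0 1) (g \<circ> (\<lambda>z. Arg2pi z / (2*pi)))"
    using homotopic_with_imp_continuous by blast
  moreover have "continuous_on (sphere 0 1) (\<lambda>z. z / w)"
    using w0 by (intro continuous_intros) auto
  ultimately have "continuous_on (sphere 0 1) ((g \<circ> (\<lambda>z. Arg2pi z / (2*pi))) \<circ> (\<lambda>z. z / w))"
    by (intro continuous_on_compose[of _ "\<lambda>z. z / w"])
      (auto simp: norm_divide w elim!: continuous_on_subset)
  then have cont: "continuous_on (sphere 0 1) (\<lambda>z. g (a z))"
    by (simp add: a_def o_def)
  have inj: "inj_on (\<lambda>z. g (a z)) (sphere 0 1)"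
  proof (rule inj_onI)
    fix z z' assume z: "z \<in> sphere 0 1" "z' \<in> sphere 0 1" "g (a z) = g (a z')"
    then have "a z = a z'" by (intro g_eq a_bounds)
    moreover have "cmod z = 1" "cmod z' = 1" using z by simp_all
    ultimately show "z = z'" using a_inv by metis
  qed
  have image: "(\<lambda>z. g (a z)) ` sphere 0 1 = path_image g"
  proof
    show "(\<lambda>z. g (a z)) ` sphere 0 1 \<subseteq> path_image g"
      using a_bounds by (auto simp: path_image_def less_imp_le)
    have "g x \<in> (\<lambda>z. g (a z)) ` sphere 0 1" if "0 \<le> x" "x < 1" for x
      using a_exp[OF that] w by (intro image_eqI[of _ _ "w * exp (2 * pi * x * \<i>)"]) (simp_all add: norm_mult)
    moreover have "g 1 = g 0" using g(2) by (simp add: pathfinish_def pathstart_def)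
    ultimately have "g x \<in> (\<lambda>z. g (a z)) ` sphere 0 1" if "0 \<le> x" "x \<le> 1" for x
      using that by (cases "x = 1") (simp_all del: image_iff)
    then show "path_image g \<subseteq> (\<lambda>z. g (a z)) ` sphere 0 1"
      unfolding path_image_def by (intro image_subsetI) simp
  qed
  obtain \<phi>' where "homeomorphism (sphere 0 1) (path_image g) (\<lambda>z. g (a z)) \<phi>'"
    using homeomorphism_compact[OF _ cont image inj] by auto
  then show ?thesis
    using a_exp by (intro exI[of _ "\<lambda>z. g (a z)"] exI[of _ \<phi>'] conjI allI impI) simp_all
qed

section \<open>Cyclic graphs as polygonal loops\<close>

text \<open>The polygonal path that passes through \<open>V i\<close> at time \<open>i\<close> for \<open>i \<le> N\<close>. The coefficients are hat functions, which
makes continuity immediate.\<close>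
definition polygon :: "nat \<Rightarrow> (nat \<Rightarrow> 'a::real_normed_vector) \<Rightarrow> real \<Rightarrow> 'a" where
  "polygon N V t = (\<Sum>i\<le>N. max 0 (1 - \<bar>t - real i\<bar>) *\<^sub>R V i)"

lemma continuous_on_polygon: "continuous_on S (polygon N V)"
  unfolding polygon_def by (intro continuous_intros)

lemma polygon_edge:
  assumes "k < N" "0 \<le> r" "r \<le> 1"
  shows "polygon N V (real k + r) = (1 - r) *\<^sub>R V k + r *\<^sub>R V (Suc k)"
proof -
  have "polygon N V (real k + r) = (\<Sum>i\<in>{k, Suc k}. max 0 (1 - \<bar>real k + r - real i\<bar>) *\<^sub>R V i)"
    unfolding polygon_def
  proof (rule sum.mono_neutral_right)
    show "\<forall>i\<in>{..N} - {k, Suc k}. max 0 (1 - \<bar>real k + r - real i\<bar>) *\<^sub>R V i = 0"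
    proof
      fix i assume "i \<in> {..N} - {k, Suc k}"
      then have "real i + 1 \<le> real k \<or> real k + 2 \<le> real i" by force
      then have "max 0 (1 - \<bar>real k + r - real i\<bar>) = 0"
        using assms by (auto simp: max_def)
      then show "max 0 (1 - \<bar>real k + r - real i\<bar>) *\<^sub>R V i = 0" by simp
    qed
  qed (use assms in auto)
  then show ?thesis using assms by simp
qed

lemma obtain_edge_parameter:
  assumes "0 \<le> t" "t < real N"
  obtains k r where "k < N" "0 \<le> r" "r < 1" "t = real k + r"
proof
  show "nat \<lfloor>t\<rfloor> < N" "0 \<le> frac t" "frac t < 1" "t = real (nat \<lfloor>t\<rfloor>) + frac t"
    using assms by (auto simp: frac_lt_1 nat_less_iff floor_less_iff) (simp add: frac_def)
qed

definition cyclic_graph :: "nat \<Rightarrow> (nat \<Rightarrow> 'v) \<Rightarrow> 'v graph" where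
  "cyclic_graph N v = (v ` {..<N}, (\<lambda>i. {v i, v (Suc i mod N)}) ` {..<N})"

abbreviation cyclic_vertex :: "nat \<Rightarrow> (nat \<Rightarrow> 'v::finite) \<Rightarrow> nat \<Rightarrow> real ^ 'v" where
  "cyclic_vertex N v i \<equiv> vertex_point (v (i mod N))"

text \<open>The coordinates of a point determine the edge it is on and its position there. Two edges in
different positions of the cycle cannot share both of their ends, as the cycle has at least three vertices.\<close>
lemma inj_on_polygon_cyclic:
  assumes v: "inj_on v {..<N}" and N: "3 \<le> N"
  shows "inj_on (polygon N (cyclic_vertex N v)) {0..<real N}"
proof (rule inj_onI)
  fix s t assume s: "s \<in> {0..<real N}" and t: "t \<in> {0..<real N}"
    and eq: "polygon N (cyclic_vertex N v) s = polygon N (cyclic_vertex N v) t"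
  obtain j q where q: "j < N" "0 \<le> q" "q < 1" "s = real j + q"
    using s by (auto elim: obtain_edge_parameter)
  obtain k r where r: "k < N" "0 \<le> r" "r < 1" "t = real k + r"
    using t by (auto elim: obtain_edge_parameter)
  have v_eq: "v x = v y \<longleftrightarrow> x = y" if "x < N" "y < N" for x y
    using v that by (auto dest: inj_onD)
  have eq': "(1 - q) *\<^sub>R vertex_point (v j) + q *\<^sub>R vertex_point (v (Suc j mod N)) =
      (1 - r) *\<^sub>R vertex_point (v k) + r *\<^sub>R vertex_point (v (Suc k mod N))"
    using eq q r polygon_edge[of j N q "cyclic_vertex N v"] polygon_edge[of k N r "cyclic_vertex N v"] by simp
  have co: "(1 - q) * of_bool (i = j) + q * of_bool (i = Suc j mod N) =
      (1 - r) * of_bool (i = k) + r * of_bool (i = Suc k mod N)" if "i < N" for i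
    using arg_cong[OF eq', of "\<lambda>x. vec_nth x (v i)"] that q(1) r(1)
    by (simp only: vector_add_component vector_scaleR_component vertex_point_nth)
      (simp add: v_eq del: of_bool_eq_iff)
  have succ: "Suc i mod N \<noteq> i" "Suc (Suc i mod N) mod N \<noteq> i" if "i < N" for i
    using that N by (auto simp: mod_Suc)
  have "j = k"
  proof (rule ccontr)
    assume "j \<noteq> k"
    then have "1 - q = r * of_bool (j = Suc k mod N)" "q * of_bool (k = Suc j mod N) = 1 - r"
      using co[of j] co[of k] q(1) r(1) succ[of j] succ[of k] by auto
    then have "j = Suc k mod N" "k = Suc j mod N"
      using q(3) r(3) by (simp_all add: of_bool_def split: if_splits)
    then show False using succ[of j] q by metis
  qed
  moreover have "q = r"
    using co[of j] \<open>j = k\<close> q succ[of j] by simp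
  ultimately show "s = t" using q r by simp
qed

lemma polygon_cyclic_closed:
  assumes "0 < N" shows "polygon N (cyclic_vertex N v) (real N) = polygon N (cyclic_vertex N v) 0"
  using polygon_edge[of "N - 1" N 1 "cyclic_vertex N v"] polygon_edge[of 0 N 0 "cyclic_vertex N v"] assms
  by simp

lemma polygon_cyclic_image:
  assumes "0 < N"
  shows "polygon N (cyclic_vertex N v) ` {0..real N} = realization (cyclic_graph N v)"
    (is "?p ` _ = _")
proof
  have edge: "?p (real k + r) \<in> edge_segment {v k, v (Suc k mod N)}" if "k < N" "0 \<le> r" "r \<le> 1" for k r
    using polygon_edge[OF that, of "cyclic_vertex N v"] that
    by (auto simp: edge_segment_doubleton in_segment)
  show "?p ` {0..real N} \<subseteq> realization (cyclic_graph N v)"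
  proof
    fix x assume "x \<in> ?p ` {0..real N}"
    then obtain t where t: "0 \<le> t" "t \<le> real N" "x = ?p t" by auto
    then have "\<exists>t\<ge>0. t < real N \<and> x = ?p t"
      using polygon_cyclic_closed[OF assms, of v] assms
      by (cases "t = real N") (auto intro: exI[of _ 0] exI[of _ t])
    then obtain k r where "k < N" "0 \<le> r" "r < 1" "x = ?p (real k + r)"
      by (auto elim: obtain_edge_parameter)
    then show "x \<in> realization (cyclic_graph N v)"
      using edge[of k r] by (auto simp: realization_def cyclic_graph_def edges_def)
  qed
  have seg: "edge_segment {v k, v (Suc k mod N)} \<subseteq> ?p ` {0..real N}" if "k < N" for k
  proof
    fix x assume "x \<in> edge_segment {v k, v (Suc k mod N)}"
    then obtain r where r: "0 \<le> r" "r \<le> 1"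
      "x = (1 - r) *\<^sub>R vertex_point (v k) + r *\<^sub>R vertex_point (v (Suc k mod N))"
      by (auto simp: edge_segment_doubleton in_segment)
    then have "x = ?p (real k + r)"
      using polygon_edge[OF \<open>k < N\<close>, of r "cyclic_vertex N v"] \<open>k < N\<close> by simp
    moreover have "real k + r \<in> {0..real N}" using r \<open>k < N\<close> by auto
    ultimately show "x \<in> ?p ` {0..real N}" by blast
  qed
  have "vertex_point (v k) \<in> edge_segment {v k, v (Suc k mod N)}" for k
    by (simp add: edge_segment_doubleton)
  then show "realization (cyclic_graph N v) \<subseteq> ?p ` {0..real N}"
    using seg by (auto simp: realization_def cyclic_graph_def edges_def verts_def)
qed

text \<open>The polygonal loop is reparametrized by a strictly increasing function that maps \<open>t i\<close> to \<open>k i + r i\<close>,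
the time at which the loop passes the point with parameter \<open>r i\<close> on the edge number \<open>k i\<close>. The values
0 and 1 are mapped to 0 and \<open>N\<close>.\<close>
lemma cyclic_graph_through_points:
  fixes v :: "nat \<Rightarrow> 'v::finite" and t r :: "nat \<Rightarrow> real" and k :: "nat \<Rightarrow> nat" and w :: complex
  assumes v: "inj_on v {..<N}" and N: "3 \<le> N" and w: "cmod w = 1"
    and t: "\<And>i. i < m \<Longrightarrow> 0 < t i \<and> t i < 1" "\<And>i. Suc i < m \<Longrightarrow> t i < t (Suc i)"
    and k: "\<And>i. i < m \<Longrightarrow> Suc (k i) < N" "\<And>i. Suc i < m \<Longrightarrow> k i < k (Suc i)"
    and r: "\<And>i. i < m \<Longrightarrow> 0 < r i \<and> r i < 1"
  shows "\<exists>\<phi> \<phi>'. homeomorphism (sphere 0 1) (realization (cyclic_graph N v)) \<phi> \<phi>' \<and>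
     (\<forall>i<m. \<phi> (w * exp (2 * pi * t i * \<i>)) =
        (1 - r i) *\<^sub>R vertex_point (v (k i)) + r i *\<^sub>R vertex_point (v (Suc (k i))))"
proof -
  let ?p = "polygon N (cyclic_vertex N v)"
  define T where "T i = (if i = 0 then 0 else if i = Suc m then 1 else t (i - 1))" for i
  define S where "S i = (if i = 0 then 0 else if i = Suc m then real N else real (k (i - 1)) + r (i - 1))" for i
  have "T i < T (Suc i)" if "i < Suc m" for i
    using that t(1)[of i] t(1)[of "i - 1"] t(2)[of "i - 1"] by (auto simp: T_def)
  moreover have "S i < S (Suc i)" if "i < Suc m" for i
  proof -
    have "real (k (i - 1)) + r (i - 1) < real (k i) + r i" if "0 < i" "i < m"
    proof -
      have "real (k (i - 1)) + 1 \<le> real (k i)" using k(2)[of "i - 1"] that by simp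
      moreover have "r (i - 1) < 1" "0 < r i" using r[of i] r[of "i - 1"] that by simp_all
      ultimately show ?thesis by linarith
    qed
    moreover have "real (k (m - 1)) + r (m - 1) < real N" if "0 < m"
      using k(1)[of "m - 1"] r[of "m - 1"] that by auto
    ultimately show ?thesis
      using that N r[of i] by (auto simp: S_def less_Suc_eq add_nonneg_pos)
  qed
  ultimately obtain u where u: "continuous_on UNIV u" "strict_mono u" "\<And>i. i \<le> Suc m \<Longrightarrow> u (T i) = S i"
    using strict_mono_interpolation[of "Suc m" T S] by metis
  have u01: "u 0 = 0" "u 1 = real N"
    using u(3)[of 0] u(3)[of "Suc m"] by (simp_all add: T_def S_def)
  have u_bounds: "0 \<le> u x \<longleftrightarrow> 0 \<le> x" "u x \<le> real N \<longleftrightarrow> x \<le> 1" "u x < real N \<longleftrightarrow> x < 1" for x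
    using strict_mono_less_eq[OF u(2), of 0 x] strict_mono_less_eq[OF u(2), of x 1]
      strict_mono_less[OF u(2), of x 1] by (simp_all add: u01)
  have u_image: "u ` {0..1} = {0..real N}"
  proof
    show "u ` {0..1} \<subseteq> {0..real N}"
      by (auto simp: u_bounds)
    show "{0..real N} \<subseteq> u ` {0..1}"
    proof
      fix y assume "y \<in> {0..real N}"
      then have "\<exists>x\<ge>0. x \<le> 1 \<and> u x = y"
        using u01 continuous_on_subset[OF u(1)] by (intro IVT') auto
      then show "y \<in> u ` {0..1}" by force
    qed
  qed
  define g where "g = ?p \<circ> u"
  have image: "path_image g = realization (cyclic_graph N v)"
    using N by (simp only: path_image_def g_def image_comp[symmetric] u_image) (simp add: polygon_cyclic_image)
  have closed: "pathfinish g = pathstart g"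
    using N by (simp add: pathfinish_def pathstart_def g_def u01 polygon_cyclic_closed)
  have inj: "x = y" if "g x = g y" "0 \<le> x" "x < 1" "0 \<le> y" "y < 1" for x y
  proof -
    have "u x \<in> {0..<real N}" "u y \<in> {0..<real N}"
      using that by (auto simp: u_bounds)
    then have "u x = u y"
      using inj_on_polygon_cyclic[OF v N] that(1) by (auto simp: g_def dest: inj_onD)
    then show "x = y" using u(2) by (simp add: strict_mono_eq)
  qed
  have "simple_path g"
    unfolding simple_path_def loop_free_def
  proof (intro conjI ballI impI)
    show "path g"
      unfolding path_def g_def
      by (intro continuous_on_compose continuous_on_polygon continuous_on_subset[OF u(1)]) auto
    fix x y :: real assume xy: "x \<in> {0..1}" "y \<in> {0..1}" "g x = g y"
    have g1: "g 1 = g 0" using closed by (simp add: pathfinish_def pathstart_def)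
    show "x = y \<or> x = 0 \<and> y = 1 \<or> x = 1 \<and> y = 0"
      using xy g1 inj[of x y] inj[of x 0] inj[of 0 y] by (cases "x = 1"; cases "y = 1") auto
  qed
  then obtain \<phi> \<phi>' where \<phi>: "homeomorphism (sphere 0 1) (path_image g) \<phi> \<phi>'"
      "\<And>x. 0 \<le> x \<Longrightarrow> x < 1 \<Longrightarrow> \<phi> (w * exp (2 * pi * x * \<i>)) = g x"
    using homeomorphism_circle_simple_loop[OF _ closed w] by blast
  have "g (t i) = (1 - r i) *\<^sub>R vertex_point (v (k i)) + r i *\<^sub>R vertex_point (v (Suc (k i)))"
    if "i < m" for i
  proof -
    have "u (t i) = real (k i) + r i"
      using u(3)[of "Suc i"] that by (simp add: T_def S_def)
    then show ?thesis
      using that k(1)[of i] r[of i] polygon_edge[of "k i" N "r i" "cyclic_vertex N v"]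
      by (simp add: g_def)
  qed
  then show ?thesis
    using \<phi> t(1) image by (intro exI[of _ \<phi>] exI[of _ \<phi>']) (simp add: less_imp_le)
qed

lemma cycle_of_cyclic_graph:
  fixes v :: "nat \<Rightarrow> 'v::finite"
  assumes v: "inj_on v {..<N}" and N: "3 \<le> N"
    and hom: "homeomorphism (sphere (0::complex) 1) (realization (cyclic_graph N v)) \<phi> \<phi>'"
  shows "cycle_of (cyclic_graph N v) complete_graph"
proof -
  have "v i \<noteq> v (Suc i mod N)" if "i < N" for i
    using inj_onD[OF v, of i "Suc i mod N"] that N by (auto simp: mod_Suc split: if_splits)
  moreover have "realization (cyclic_graph N v) homeomorphic sphere (0::complex) 1"
    using hom homeomorphic_sym homeomorphic_def by blast
  ultimately show ?thesis
    using N by (auto simp: cycle_of_def subgraph_def simple_graph_def cyclic_graph_def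
      complete_graph_def verts_def edges_def card_2_iff)
qed

lemma card_verts_cyclic_graph:
  "inj_on v {..<N} \<Longrightarrow> card (verts (cyclic_graph N v)) = N"
  by (simp add: cyclic_graph_def verts_def card_image)

section \<open>Choosing the crossings and the cycle\<close>

text \<open>Entries \<open>2 * e\<close> and \<open>2 * e + 1\<close> of the sequence \<open>D\<close> are the ends of an edge number \<open>e\<close>; edges \<open>2 * j\<close>
and \<open>2 * j + 1\<close> cross.\<close>
definition crossing_pairs :: "(real ^ 'v \<Rightarrow> real ^ 2) \<Rightarrow> nat \<Rightarrow> (nat \<Rightarrow> 'v::finite) \<Rightarrow> bool" where
  "crossing_pairs f m D \<longleftrightarrow>
     (\<forall>j<m. crosses f (D (4 * j)) (D (4 * j + 1)) (D (4 * j + 2)) (D (4 * j + 3)))"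

definition append_quadruple :: "nat \<Rightarrow> (nat \<Rightarrow> 'v) \<Rightarrow> 'v \<Rightarrow> 'v \<Rightarrow> 'v \<Rightarrow> 'v \<Rightarrow> nat \<Rightarrow> 'v" where
  "append_quadruple m D a b c d i = (if i < 4 * m then D i else [a, b, c, d] ! (i - 4 * m))"

lemma append_quadruple_simps [simp]:
  "i < 4 * m \<Longrightarrow> append_quadruple m D a b c d i = D i"
  "append_quadruple m D a b c d (4 * m) = a"
  "append_quadruple m D a b c d (Suc (4 * m)) = b"
  "append_quadruple m D a b c d (Suc (Suc (4 * m))) = c"
  "append_quadruple m D a b c d (4 * m + 3) = d"
  by (simp_all add: append_quadruple_def numeral_3_eq_3)

lemma lessThan_4_Suc: "{..<4 * Suc m} = {..<4 * m} \<union> {4 * m, Suc (4 * m), Suc (Suc (4 * m)), 4 * m + 3}"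
  by auto

lemma crossing_pairs_append_quadruple:
  assumes "crossing_pairs f m D" "crosses f a b c d"
  shows "crossing_pairs f (Suc m) (append_quadruple m D a b c d)"
  using assms by (auto simp: crossing_pairs_def less_Suc_eq)

text \<open>The first part allows \<open>a\<close> to be an old vertex: the only repetition is then at index \<open>4 * m\<close>.\<close>
lemma inj_on_append_quadruple:
  assumes "inj_on D {..<4 * m}" "{b, c, d} \<inter> D ` {..<4 * m} = {}" "distinct [b, c, d]"
  shows "inj_on (append_quadruple m D a b c d) ({..<4 * Suc m} - {4 * m})"
    and "a \<notin> {b, c, d} \<union> D ` {..<4 * m} \<Longrightarrow> inj_on (append_quadruple m D a b c d) {..<4 * Suc m}"
proof -
  have D: "D i = D j \<longleftrightarrow> i = j" if "i < 4 * m" "j < 4 * m" for i j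
    using assms(1) that by (auto dest: inj_onD)
  have notin: "D i \<noteq> b" "D i \<noteq> c" "D i \<noteq> d" if "i < 4 * m" for i
    using assms(2) that by auto
  note [simp] = D notin notin[symmetric]
  show "inj_on (append_quadruple m D a b c d) ({..<4 * Suc m} - {4 * m})"
    unfolding lessThan_4_Suc using assms(3) by (intro inj_onI) (auto simp del: mult_Suc_right)
  show "inj_on (append_quadruple m D a b c d) {..<4 * Suc m}"
    if "a \<notin> {b, c, d} \<union> D ` {..<4 * m}"
  proof -
    have "D i \<noteq> a" if "i < 4 * m" for i
      using \<open>a \<notin> _\<close> that by auto
    note [simp] = this this[symmetric]
    show ?thesis
      unfolding lessThan_4_Suc using assms(3) that by (intro inj_onI) (auto simp del: mult_Suc_right)
  qed
qed

text \<open>Greedy choice: at least five vertices remain before each step.\<close>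
lemma disjoint_crossings:
  fixes f :: "real ^ 'v::finite \<Rightarrow> real ^ 2"
  assumes gen: "generic_immersion complete_graph f" and "4 * m < CARD('v)"
  shows "\<exists>D. inj_on D {..<4 * m} \<and> crossing_pairs f m D"
  using assms(2)
proof (induction m)
  case 0
  show ?case by (simp add: crossing_pairs_def)
next
  case (Suc m)
  then obtain D where D: "inj_on D {..<4 * m}" "crossing_pairs f m D"
    by auto
  have "card (- D ` {..<4 * m}) = CARD('v) - 4 * m"
    using D(1) by (simp add: Compl_eq_Diff_UNIV card_Diff_subset card_image)
  then have "5 \<le> card (- D ` {..<4 * m})"
    using Suc.prems by simp
  then obtain S where S: "S \<subseteq> - D ` {..<4 * m}" "card S = 5"
    by (metis obtain_subset_with_card_n)
  then obtain a b c d where "{a, b, c, d} \<subseteq> S" and cr: "crosses f a b c d"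
    using crossing_in_five_vertices[OF gen] by blast
  then have "inj_on (append_quadruple m D a b c d) {..<4 * Suc m}"
    using S(1) D(1) by (intro inj_on_append_quadruple(2)) (auto simp: crosses_def)
  then show ?case using crossing_pairs_append_quadruple[OF D(2) cr] by blast
qed

text \<open>The last crossing is sought among the four remaining vertices together with \<open>D 1\<close>, an end of the edge
number 0. If it uses \<open>D 1\<close>, the symmetries of \<open>crosses\<close> allow to list this vertex first, so that the edge
number \<open>2 * m\<close> starts where the edge number 0 ends.\<close>
lemma crossings_covering_almost_all_vertices:
  fixes f :: "real ^ 'v::finite \<Rightarrow> real ^ 2"
  assumes gen: "generic_immersion complete_graph f" and n: "CARD('v) = 4 * Suc m" "0 < m"
  shows "\<exists>D. crossing_pairs f (Suc m) D \<and>
     (inj_on D {..<4 * Suc m} \<or> inj_on D ({..<4 * Suc m} - {4 * m}) \<and> D (4 * m) = D 1)"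
proof -
  obtain D where D: "inj_on D {..<4 * m}" "crossing_pairs f m D"
    using disjoint_crossings[OF gen, of m] n by auto
  define W where "W = - D ` {..<4 * m}"
  have "card W = 4"
    using D(1) n by (simp add: W_def Compl_eq_Diff_UNIV card_Diff_subset card_image)
  moreover have q: "D 1 \<notin> W"
    using n by (auto simp: W_def)
  ultimately have "card (insert (D 1) W) = 5" by simp
  from crossing_in_five_vertices[OF gen this]
  obtain a b c d where abcd: "{a, b, c, d} \<subseteq> insert (D 1) W" "crosses f a b c d"
    by (elim exE conjE)
  have "\<exists>a b c d. {b, c, d} \<subseteq> W \<and> a \<in> insert (D 1) W \<and> crosses f a b c d"
  proof (cases "D 1 \<in> {a, b, c, d}")
    case True
    have start: ?thesis if "crosses f a' b' c' d'" "{a', b', c', d'} = {a, b, c, d}" "a' = D 1" for a' b' c' d'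
    proof -
      have "distinct [a', b', c', d']" using that(1) by (simp add: crosses_def)
      moreover have "{a', b', c', d'} \<subseteq> insert a' W" using abcd(1) that(2,3) by simp
      ultimately have "{b', c', d'} \<subseteq> W" by auto
      then show ?thesis using that(1,3) by blast
    qed
    have "crosses f b a c d" "crosses f c d a b" "crosses f d c a b"
      using abcd(2) crosses_sym by blast+
    then show ?thesis
      using True abcd(2) start[of a b c d] start[of b a c d] start[of c d a b] start[of d c a b]
      by (auto simp: insert_commute)
  next
    case False
    then show ?thesis using abcd by (intro exI[of _ a] exI[of _ b] exI[of _ c] exI[of _ d]) auto
  qed
  then obtain a b c d where abcd: "{b, c, d} \<subseteq> W" "a \<in> insert (D 1) W" "crosses f a b c d"
    by blast
  then have dist: "distinct [a, b, c, d]" by (simp add: crosses_def)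
  let ?D = "append_quadruple m D a b c d"
  have "inj_on ?D {..<4 * Suc m} \<or> inj_on ?D ({..<4 * Suc m} - {4 * m}) \<and> ?D (4 * m) = ?D 1"
  proof (cases "a = D 1")
    case True
    then show ?thesis
      using D(1) dist abcd n(2) by (intro disjI2 conjI inj_on_append_quadruple) (auto simp: W_def)
  next
    case False
    then show ?thesis
      using D(1) dist abcd by (intro disjI1 inj_on_append_quadruple) (auto simp: W_def)
  qed
  then show ?thesis using crossing_pairs_append_quadruple[OF D(2) abcd(3)] by blast
qed

text \<open>Here \<open>M\<close> edges are to be traversed in the order \<open>\<pi> 0, \<pi> 1, \<dots>\<close>, and \<open>k i\<close> is the position in the cyclic
sequence \<open>v\<close> at which the \<open>i\<close>-th of them starts. If all ends are distinct, they are simply listed. If the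
edges \<open>0\<close> and \<open>l\<close> have a common vertex, they are assumed to be consecutive, at \<open>h\<close> and \<open>Suc h\<close>. The
repeated vertex at index \<open>2 * h + 2\<close> is skipped, which shifts all later positions by one, and the vertex
\<open>w\<close> not on any of the edges is put at the end.\<close>
lemma vertex_sequence_through_edges:
  fixes D :: "nat \<Rightarrow> 'v::finite"
  assumes card: "CARD('v) = 2 * M"
    and D: "inj_on D {..<2 * M} \<or> inj_on D ({..<2 * M} - {2 * l}) \<and> D (2 * l) = D 1"
    and \<pi>: "bij_betw \<pi> {..<M} {..<M}" "Suc h < M" "\<pi> h = 0" "\<pi> (Suc h) = l"
  shows "\<exists>v k. inj_on v {..<2 * M} \<and> (\<forall>i<M. Suc (k i) < 2 * M) \<and> (\<forall>i. Suc i < M \<longrightarrow> k i < k (Suc i)) \<and>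
     (\<forall>i<M. v (k i) = D (2 * \<pi> i) \<and> v (Suc (k i)) = D (2 * \<pi> i + 1))"
proof -
  \<comment> \<open>\<open>D \<circ> \<rho>\<close> lists the ends of the edges in the order of traversal.\<close>
  define \<rho> where "\<rho> j = 2 * \<pi> (j div 2) + j mod 2" for j
  have \<rho>_less: "\<rho> j < 2 * M" if "j < 2 * M" for j
  proof -
    have "\<pi> (j div 2) < M" using \<pi>(1) that by (auto simp: bij_betw_def)
    then show ?thesis by (simp add: \<rho>_def)
  qed
  have \<rho>_inj: "inj_on \<rho> {..<2 * M}"
  proof (rule inj_onI)
    fix i j assume ij: "i \<in> {..<2 * M}" "j \<in> {..<2 * M}" "\<rho> i = \<rho> j"
    then have "i mod 2 = j mod 2" "\<pi> (i div 2) = \<pi> (j div 2)"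
      unfolding \<rho>_def by presburger+
    moreover from this have "i div 2 = j div 2"
      using \<pi>(1) ij by (auto simp: bij_betw_def dest: inj_onD)
    ultimately show "i = j" by (metis div_mult_mod_eq)
  qed
  have \<rho>_simps: "\<rho> (2 * i) = 2 * \<pi> i" "\<rho> (Suc (2 * i)) = 2 * \<pi> i + 1" for i
    by (simp_all add: \<rho>_def)
  from D show ?thesis
  proof
    assume "inj_on D {..<2 * M}"
    then have "inj_on (D \<circ> \<rho>) {..<2 * M}"
      using \<rho>_less by (intro comp_inj_on \<rho>_inj) (auto elim: inj_on_subset)
    then show ?thesis
      by (intro exI[of _ "D \<circ> \<rho>"] exI[of _ "\<lambda>i. 2 * i"]) (simp add: \<rho>_simps)
  next
    assume D: "inj_on D ({..<2 * M} - {2 * l}) \<and> D (2 * l) = D 1"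
    have \<rho>_l: "\<rho> j = 2 * l \<longleftrightarrow> j = 2 * h + 2" if "j < 2 * M" for j
      using inj_onD[OF \<rho>_inj, of j "2 * Suc h"] that \<pi>(2,4) \<rho>_simps(1)[of "Suc h"] by auto
    have D\<rho>_inj: "i = j" if "D (\<rho> i) = D (\<rho> j)" "i < 2 * M" "j < 2 * M" "i \<noteq> 2 * h + 2" "j \<noteq> 2 * h + 2" for i j
    proof -
      have "\<rho> i \<in> {..<2 * M} - {2 * l}" "\<rho> j \<in> {..<2 * M} - {2 * l}"
        using that \<rho>_less \<rho>_l by auto
      then have "\<rho> i = \<rho> j" using D that(1) by (auto dest!: inj_onD)
      then show ?thesis using inj_onD[OF \<rho>_inj] that by simp
    qed
    have "l < M" using \<pi>(1,2,4) by (auto simp: bij_betw_def)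
    have "1 \<in> {..<2 * M} - {2 * l}"
      using \<pi>(2) by simp
    then have "D i \<in> D ` ({..<2 * M} - {2 * l})" if "i < 2 * M" for i
      using D that by (cases "i = 2 * l") auto
    then have "D ` {..<2 * M} \<subseteq> D ` ({..<2 * M} - {2 * l})"
      by blast
    then have "card (D ` {..<2 * M}) \<le> card (D ` ({..<2 * M} - {2 * l}))"
      by (intro card_mono) auto
    also have "\<dots> < CARD('v)"
      using card D \<open>l < M\<close> by (simp add: card_image)
    finally have "D ` {..<2 * M} \<noteq> UNIV" by auto
    then obtain w where w: "w \<notin> D ` {..<2 * M}" by auto
    define \<sigma> where "\<sigma> j = (if j < 2 * h + 2 then j else Suc j)" for j
    have \<sigma>: "\<sigma> j < 2 * M" "\<sigma> j \<noteq> 2 * h + 2" if "j < 2 * M - 1" for j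
      using that \<pi>(2) by (auto simp: \<sigma>_def)
    have \<sigma>_inj: "i = j" if "\<sigma> i = \<sigma> j" for i j
      using that by (auto simp: \<sigma>_def split: if_splits)
    define v where "v j = (if j < 2 * M - 1 then D (\<rho> (\<sigma> j)) else w)" for j
    define k where "k i = (if i \<le> h then 2 * i else 2 * i - 1)" for i
    have "inj_on v {..<2 * M}"
    proof (rule inj_onI)
      fix i j assume ij: "i \<in> {..<2 * M}" "j \<in> {..<2 * M}" "v i = v j"
      have w': "D (\<rho> (\<sigma> i)) \<noteq> w" if "i < 2 * M - 1" for i
        using w \<rho>_less[OF \<sigma>(1)[OF that]] by auto
      consider "i < 2 * M - 1" "j < 2 * M - 1" | "i = 2 * M - 1" "j = 2 * M - 1"
        using ij w'[of i] w'[of j] by (cases "i < 2 * M - 1"; cases "j < 2 * M - 1") (auto simp: v_def)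
      then show "i = j"
      proof cases
        case 1
        then have "\<sigma> i = \<sigma> j"
          using ij(3) \<sigma>[of i] \<sigma>[of j] by (intro D\<rho>_inj) (simp_all add: v_def)
        then show ?thesis by (rule \<sigma>_inj)
      qed simp
    qed
    moreover have "\<forall>i<M. Suc (k i) < 2 * M" "\<forall>i. Suc i < M \<longrightarrow> k i < k (Suc i)"
      using \<pi>(2) by (auto simp: k_def)
    moreover have "v (k i) = D (2 * \<pi> i) \<and> v (Suc (k i)) = D (2 * \<pi> i + 1)" if "i < M" for i
    proof (cases "i \<le> h")
      case True
      then have "2 * i < 2 * M - 1" "Suc (2 * i) < 2 * M - 1" "Suc (2 * i) < 2 * h + 2"
        using \<pi>(2) by linarith+
      then show ?thesis using True by (simp add: v_def k_def \<sigma>_def \<rho>_simps)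
    next
      case False
      then obtain i' where i': "i = Suc i'" "h \<le> i'" by (cases i) auto
      have less: "Suc (2 * i') < 2 * M - 1" "Suc (Suc (2 * i')) < 2 * M - 1"
        using that i' by linarith+
      show ?thesis
      proof (cases "i' = h")
        case True
        then show ?thesis
          using less D \<pi> i' \<rho>_simps(2)[of h] \<rho>_simps[of "Suc h"] by (simp add: v_def k_def \<sigma>_def)
      next
        case False
        then show ?thesis
          using less i' \<rho>_simps[of "Suc i'"] by (simp add: v_def k_def \<sigma>_def)
      qed
    qed
    ultimately show ?thesis by blast
  qed
qed

section \<open>Chord diagrams\<close>

text \<open>The points are sorted by their angle from a base point \<open>w\<close> outside of \<open>P\<close>, so that no parameter is 0.\<close>
lemma finite_subset_of_circle_in_order:
  assumes P: "finite P" "P \<subseteq> sphere (0::complex) 1"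
  shows "\<exists>w t. cmod w = 1 \<and> (\<forall>i<card P. 0 < t i \<and> t i < 1) \<and>
    (\<forall>i. Suc i < card P \<longrightarrow> t i < t (Suc i)) \<and>
    bij_betw (\<lambda>i. w * exp (2 * pi * t i * \<i>)) {..<card P} P"
proof -
  have "infinite (sphere (0::complex) 1)"
  proof
    assume fin: "finite (sphere (0::complex) 1)"
    have "connected (sphere (0::complex) 1)"
      by (rule connected_sphere) simp
    from connected_finite_iff_sing[OF this] fin
    obtain a :: complex where "sphere 0 1 \<subseteq> {a}"
      by (metis empty_subsetI order_refl)
    moreover have "1 \<in> sphere (0::complex) 1" "-1 \<in> sphere (0::complex) 1" by simp_all
    ultimately have "1 = a" "-1 = a" by blast+
    then show False by simp
  qed
  then obtain w where w: "cmod w = 1" "w \<notin> P"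
    using P(1) by (metis infinite_super mem_sphere_0 subsetI)
  have w0: "w \<noteq> 0" using w by auto
  define a where "a z = Arg2pi (z / w) / (2 * pi)" for z
  have a_inv: "w * exp (2 * pi * a z * \<i>) = z" if "z \<in> P" for z
    using Arg2pi_eq[of "z / w"] w w0 that P(2) by (auto simp: a_def norm_divide field_simps)
  have a_bounds: "0 < a z \<and> a z < 1" if "z \<in> P" for z
  proof -
    have "a z \<noteq> 0" using a_inv[OF that] that w(2) by auto
    then show ?thesis
      using Arg2pi_ge_0[of "z / w"] Arg2pi_lt_2pi[of "z / w"] by (auto simp: a_def order_less_le)
  qed
  have inj: "inj_on a P" using a_inv by (metis inj_onI)
  define L where "L = sorted_list_of_set (a ` P)"
  have L: "set L = a ` P" "distinct L" "length L = card P" "sorted_wrt (<) L"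
    using P(1) inj by (simp_all add: L_def card_image)
  have nth: "L ! i \<in> a ` P" if "i < card P" for i
    using that L by (metis nth_mem)
  have "bij_betw ((!) L) {..<card P} (a ` P)"
    using L by (intro bij_betw_nth) auto
  moreover have "bij_betw (\<lambda>x. w * exp (2 * pi * x * \<i>)) (a ` P) P"
    using a_inv by (intro bij_betw_byWitness[where f' = a]) auto
  ultimately have "bij_betw (\<lambda>i. w * exp (2 * pi * (L ! i) * \<i>)) {..<card P} P"
    using bij_betw_trans by (fastforce simp: o_def)
  moreover have "0 < L ! i \<and> L ! i < 1" if "i < card P" for i
  proof -
    obtain z where "z \<in> P" "L ! i = a z" using nth[OF \<open>i < card P\<close>] by (elim imageE)
    then show ?thesis using a_bounds by simp
  qed
  moreover have "L ! i < L ! Suc i" if "Suc i < card P" for i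
    using sorted_wrt_nth_less[OF L(4), of i "Suc i"] L(3) that by simp
  ultimately show ?thesis using w(1) by (intro exI[of _ w] exI[of _ "(!) L"]) simp
qed

text \<open>Chords are numbered with \<open>cx\<close> first and \<open>cy\<close> last, and in each chord one endpoint is called the first one, in
\<open>cx\<close> and \<open>cy\<close> the points \<open>x\<close> and \<open>y\<close>. The label is then the number of the edge on which the endpoint is to
be placed: edges \<open>2 * j\<close> and \<open>2 * j + 1\<close> carry the chord number \<open>j\<close>. The labels \<open>0\<close> and \<open>2 * m\<close> are those of the edges
that may have a common vertex.\<close>
lemma chord_labelling:
  assumes part: "partition_on P \<C>" and card: "card \<C> = Suc m" "\<And>c. c \<in> \<C> \<Longrightarrow> card c = 2"
    and P: "finite P" "card P = 2 * Suc m"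
    and xy: "x \<in> cx" "cx \<in> \<C>" "y \<in> cy" "cy \<in> \<C>" "cx \<noteq> cy"
  shows "\<exists>\<rho>. bij_betw \<rho> P {..<2 * Suc m} \<and> \<rho> x = 0 \<and> \<rho> y = 2 * m \<and>
     (\<forall>c\<in>\<C>. \<exists>j<Suc m. \<exists>a b. c = {a, b} \<and> \<rho> a = 2 * j \<and> \<rho> b = 2 * j + 1)"
proof -
  have fin: "finite \<C>" using card(1) by (simp add: card_ge_0_finite)
  have same: "c = d" if "c \<in> \<C>" "d \<in> \<C>" "z \<in> c" "z \<in> d" for c d z
    using partition_onD2[OF part] that by (auto simp: disjoint_def)
  have m: "0 < m"
  proof -
    have "card {cx, cy} \<le> card \<C>" using xy fin by (intro card_mono) auto
    then show ?thesis using xy(5) card(1) by simp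
  qed
  have "\<exists>e. bij_betw e \<C> {..<Suc m} \<and> e cx = 0 \<and> e cy = m"
  proof -
    have "card (\<C> - {cx, cy}) = card {1..<m}"
      using xy card(1) fin by (simp add: card_Diff_subset)
    then obtain e where e: "bij_betw e (\<C> - {cx, cy}) {1..<m}"
      using finite_same_card_bij[of "\<C> - {cx, cy}" "{1..<m}"] fin by auto
    define e' where "e' = e(cx := 0, cy := m)"
    have "bij_betw e' ((\<C> - {cx, cy}) \<union> {cx, cy}) ({1..<m} \<union> {0, m})"
    proof (rule bij_betw_combine)
      show "bij_betw e' (\<C> - {cx, cy}) {1..<m}"
        using e bij_betw_cong[of "\<C> - {cx, cy}" e' e] by (simp add: e'_def)
      show "bij_betw e' {cx, cy} {0, m}"
        using xy(5) m by (auto simp: e'_def bij_betw_def)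
    qed auto
    moreover have "(\<C> - {cx, cy}) \<union> {cx, cy} = \<C>" "{1..<m} \<union> {0, m} = {..<Suc m}"
      using xy by auto
    ultimately show ?thesis using xy(5) by (intro exI[of _ e']) (simp add: e'_def)
  qed
  then obtain e where e: "bij_betw e \<C> {..<Suc m}" "e cx = 0" "e cy = m" by blast
  have "\<exists>a. a \<in> c" if "c \<in> \<C>" for c using card(2)[OF that] by (auto simp: card_2_iff)
  then obtain s0 where s0: "\<And>c. c \<in> \<C> \<Longrightarrow> s0 c \<in> c" by metis
  define s where "s = s0(cx := x, cy := y)"
  have s: "s c \<in> c" if "c \<in> \<C>" for c using s0 xy that by (simp add: s_def)
  have "\<exists>c. c \<in> \<C> \<and> z \<in> c" if "z \<in> P" for z using partition_onD1[OF part] that by auto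
  then obtain ch where ch: "\<And>z. z \<in> P \<Longrightarrow> ch z \<in> \<C>" "\<And>z. z \<in> P \<Longrightarrow> z \<in> ch z" by metis
  have inP: "z \<in> P" if "z \<in> c" "c \<in> \<C>" for z c using that partition_onD1[OF part] by blast
  have ch_eq: "ch z = c" if "z \<in> c" "c \<in> \<C>" for z c
    using that ch inP same by blast
  define \<rho> where "\<rho> z = 2 * e (ch z) + of_bool (z \<noteq> s (ch z))" for z
  have pair: "\<exists>b. c = {s c, b} \<and> b \<noteq> s c" if "c \<in> \<C>" for c
    using card(2)[OF that] s[OF that] by (auto simp: card_2_iff)
  have inj: "inj_on \<rho> P"
  proof (rule inj_onI)
    fix z z' assume z: "z \<in> P" "z' \<in> P" "\<rho> z = \<rho> z'"
    then have "e (ch z) = e (ch z')" "z = s (ch z) \<longleftrightarrow> z' = s (ch z')"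
      unfolding \<rho>_def by (simp_all add: of_bool_def split: if_splits) presburger+
    moreover from this have "ch z = ch z'"
      using e(1) z ch(1) by (auto simp: bij_betw_def dest: inj_onD)
    ultimately show "z = z'"
      using pair[OF ch(1), of z] ch(2)[of z] ch(2)[of z'] z by (metis empty_iff insert_iff)
  qed
  have "\<rho> ` P \<subseteq> {..<2 * Suc m}"
  proof (rule image_subsetI)
    fix z assume "z \<in> P"
    then have "e (ch z) < Suc m" using e(1) ch(1) by (auto simp: bij_betw_def)
    then show "\<rho> z \<in> {..<2 * Suc m}" by (auto simp: \<rho>_def of_bool_def)
  qed
  then have "\<rho> ` P = {..<2 * Suc m}"
    using inj P(2) by (intro card_subset_eq) (auto simp: card_image)
  then have "bij_betw \<rho> P {..<2 * Suc m}" using inj by (simp add: bij_betw_def)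
  moreover have "\<rho> x = 0" "\<rho> y = 2 * m"
    using xy ch_eq e by (simp_all add: \<rho>_def s_def)
  moreover have "\<exists>j<Suc m. \<exists>a b. c = {a, b} \<and> \<rho> a = 2 * j \<and> \<rho> b = 2 * j + 1" if c: "c \<in> \<C>" for c
  proof -
    obtain b where b: "c = {s c, b}" "b \<noteq> s c" using pair[OF c] by blast
    then have "ch (s c) = c" "ch b = c" using c ch_eq by blast+
    then have "\<rho> (s c) = 2 * e c" "\<rho> b = 2 * e c + 1" using b by (simp_all add: \<rho>_def)
    moreover have "e c < Suc m" using e(1) c by (auto simp: bij_betw_def)
    ultimately show ?thesis using b(1) by blast
  qed
  ultimately show ?thesis by blast
qed

lemma crossing_points:
  assumes "crossing_pairs f m D"
  shows "\<exists>X r. (\<forall>j<m. realization complete_graph \<inter> f -` {f (X (2 * j))} = {X (2 * j), X (2 * j + 1)}) \<and>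
    (\<forall>e<2 * m. 0 < r e \<and> r e < (1::real) \<and>
       X e = (1 - r e) *\<^sub>R vertex_point (D (2 * e)) + r e *\<^sub>R vertex_point (D (2 * e + 1)))"
proof -
  have "\<exists>x y. x \<in> open_segment (vertex_point (D (4 * j))) (vertex_point (D (4 * j + 1))) \<and>
    y \<in> open_segment (vertex_point (D (4 * j + 2))) (vertex_point (D (4 * j + 3))) \<and>
    realization complete_graph \<inter> f -` {f x} = {x, y}" if "j < m" for j
    using assms that unfolding crossing_pairs_def crosses_def by blast
  then obtain x y where xy: "\<And>j. j < m \<Longrightarrow> x j \<in> open_segment (vertex_point (D (4 * j))) (vertex_point (D (4 * j + 1)))"
    "\<And>j. j < m \<Longrightarrow> y j \<in> open_segment (vertex_point (D (4 * j + 2))) (vertex_point (D (4 * j + 3)))"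
    "\<And>j. j < m \<Longrightarrow> realization complete_graph \<inter> f -` {f (x j)} = {x j, y j}"
    by metis
  define X where "X e = (if even e then x (e div 2) else y (e div 2))" for e
  have "\<exists>r. 0 < r \<and> r < (1::real) \<and>
       X e = (1 - r) *\<^sub>R vertex_point (D (2 * e)) + r *\<^sub>R vertex_point (D (2 * e + 1))" if "e < 2 * m" for e
  proof -
    have "X e \<in> open_segment (vertex_point (D (2 * e))) (vertex_point (D (2 * e + 1)))"
    proof (cases "even e")
      case True
      then obtain j where "e = 2 * j" by (elim evenE)
      then show ?thesis using xy(1)[of j] that by (simp add: X_def)
    next
      case False
      then obtain j where "e = 2 * j + 1" by (elim oddE)
      then show ?thesis using xy(2)[of j] that by (simp add: X_def numeral_3_eq_3)
    qed
    then show ?thesis by (auto simp: in_segment)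
  qed
  then obtain r where "\<And>e. e < 2 * m \<Longrightarrow> 0 < r e \<and> r e < (1::real) \<and>
       X e = (1 - r e) *\<^sub>R vertex_point (D (2 * e)) + r e *\<^sub>R vertex_point (D (2 * e + 1))"
    by metis
  moreover have "\<forall>j<m. realization complete_graph \<inter> f -` {f (X (2 * j))} = {X (2 * j), X (2 * j + 1)}"
    using xy(3) by (simp add: X_def)
  ultimately show ?thesis by blast
qed

lemma realization_mono: "subgraph H G \<Longrightarrow> realization H \<subseteq> realization G"
  by (auto simp: subgraph_def realization_def)

text \<open>In the application \<open>R\<close> is the realization of the whole graph; fibres of \<open>f\<close> on \<open>R\<close> that lie in \<open>S\<close> are
fibres on \<open>S\<close>. The orientation of \<open>S\<close> is the one given by \<open>\<phi>\<close>, so \<open>\<phi>'\<close> corresponds to the identity of the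
circle, which has degree 1.\<close>
lemma transported_chord_diagram:
  fixes \<phi> :: "complex \<Rightarrow> real ^ 'v::finite" and f :: "real ^ 'v \<Rightarrow> real ^ 2"
  assumes hom: "homeomorphism (sphere 0 1) S \<phi> \<phi>'"
    and \<C>: "n_chord_diagram n (sphere 0 1) \<C>"
    and S: "S \<subseteq> R"
    and chords: "\<And>c. c \<in> \<C> \<Longrightarrow> \<exists>p. R \<inter> f -` {p} = \<phi> ` c"
  shows "sub_chord_diagram S ((`) \<phi> ` \<C>) (chord_diagram_of_map f S)"
    and "equivalent_chord_diagrams \<phi> S ((`) \<phi> ` \<C>) id (sphere 0 1) \<C>"
proof -
  have inv: "\<phi>' (\<phi> z) = z" if "z \<in> sphere 0 1" for z
    using hom that by (simp add: homeomorphism_def)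
  have inj: "inj_on \<phi> (sphere 0 1)" using inv by (metis inj_onI)
  obtain P where P: "P \<subseteq> sphere 0 1" "finite P" "card P = 2 * n" "partition_on P \<C>" "card \<C> = n"
    "\<And>c. c \<in> \<C> \<Longrightarrow> card c = 2"
    using \<C> unfolding n_chord_diagram_def by blast
  have c_sub: "c \<subseteq> sphere 0 1" if "c \<in> \<C>" for c
    using partition_onD1[OF P(4)] P(1) that by blast
  have injP: "inj_on \<phi> P" using inj P(1) by (rule inj_on_subset)
  have "{} \<notin> (`) \<phi> ` \<C>"
    using P(6) by fastforce
  then have "partition_on (\<phi> ` P) ((`) \<phi> ` \<C>)"
    using partition_on_inj_image[OF P(4) injP] by simp
  moreover have "card ((`) \<phi> ` \<C>) = n"
    using P(5) partition_onD1[OF P(4)] inj_on_image[of \<phi> \<C>] injP by (simp add: card_image)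
  moreover have card_c: "card (\<phi> ` c) = 2" if "c \<in> \<C>" for c
    using P(6)[OF that] inj_on_subset[OF inj c_sub[OF that]] by (simp add: card_image)
  moreover have "\<phi> ` P \<subseteq> S" using hom P(1) by (auto simp: homeomorphism_def)
  ultimately have nD: "n_chord_diagram n S ((`) \<phi> ` \<C>)"
    unfolding n_chord_diagram_def using P(2,3) injP
    by (intro exI[of _ "\<phi> ` P"]) (auto simp: card_image)
  have "(`) \<phi> ` \<C> \<subseteq> chord_diagram_of_map f S"
  proof (rule image_subsetI)
    fix c assume c: "c \<in> \<C>"
    then obtain p where "R \<inter> f -` {p} = \<phi> ` c" using chords by blast
    moreover have "\<phi> ` c \<subseteq> S" using hom c_sub[OF c] by (auto simp: homeomorphism_def)
    ultimately have "S \<inter> f -` {p} = \<phi> ` c" using S by blast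
    then show "\<phi> ` c \<in> chord_diagram_of_map f S"
      unfolding chord_diagram_of_map_def double_points_def
      using card_c[OF c] by (intro CollectI exI[of _ p]) simp
  qed
  with nD show "sub_chord_diagram S ((`) \<phi> ` \<C>) (chord_diagram_of_map f S)"
    by (auto simp: sub_chord_diagram_def)
  have "(inv_into (sphere 0 1) id \<circ> \<phi>' \<circ> \<phi> \<circ> circlepath 0 1) = circlepath 0 1"
  proof
    fix x
    have "circlepath 0 1 x \<in> sphere 0 1" by (simp add: circlepath)
    then show "(inv_into (sphere 0 1) id \<circ> \<phi>' \<circ> \<phi> \<circ> circlepath 0 1) x = circlepath 0 1 x"
      using inv inv_into_f_f[of id "sphere 0 1" "circlepath 0 1 x"] by simp
  qed
  then have "winding_number (inv_into (sphere 0 1) id \<circ> \<phi>' \<circ> \<phi> \<circ> circlepath 0 1) 0 = 1"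
    by (simp add: winding_number_circlepath_centre)
  then have "orientation_preserving_homeomorphism \<phi> S id (sphere 0 1) \<phi>'"
    using homeomorphism_symD[OF hom] by (auto simp: orientation_preserving_homeomorphism_def)
  moreover have "\<phi>' ` \<phi> ` c = c" if "c \<in> \<C>" for c
    using inv c_sub[OF that] by (force simp: image_image)
  ultimately show "equivalent_chord_diagrams \<phi> S ((`) \<phi> ` \<C>) id (sphere 0 1) \<C>"
    unfolding equivalent_chord_diagrams_def using nD \<C> by auto
qed

section \<open>Every chord diagram is a sub-chord diagram\<close>
theorem theorem1p1:
  fixes n :: nat
    and \<C> :: "complex set set"
    and f :: "real ^ 'v::finite \<Rightarrow> real ^ 2"
  assumes "n \<ge> 2"
    and "n_chord_diagram n (sphere 0 1) \<C>"
    and "CARD('v) = 4 * n"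
    and "generic_immersion (complete_graph :: 'v graph) f"
  shows "\<exists>(\<gamma> :: 'v graph) \<phi> \<D>.
           cycle_of \<gamma> complete_graph \<and> card (verts \<gamma>) = 4 * n \<and>
           orientation_of \<phi> (realization \<gamma>) \<and>
           sub_chord_diagram (realization \<gamma>) \<D> (chord_diagram_of_map f (realization \<gamma>)) \<and>
           equivalent_chord_diagrams \<phi> (realization \<gamma>) \<D> id (sphere 0 1) \<C>"
proof -
  obtain m where m: "n = Suc m" "0 < m" using assms(1) by (cases n) auto
  obtain P where P: "P \<subseteq> sphere 0 1" "finite P" "card P = 2 * n" "partition_on P \<C>" "card \<C> = n"
    "\<And>c. c \<in> \<C> \<Longrightarrow> card c = 2"
    using assms(2) unfolding n_chord_diagram_def by blast
  obtain w t where w: "cmod w = 1" and t: "\<And>i. i < 2 * n \<Longrightarrow> 0 < t i \<and> t i < 1"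
    "\<And>i. Suc i < 2 * n \<Longrightarrow> t i < t (Suc i)"
    and bij: "bij_betw (\<lambda>i. w * exp (2 * pi * t i * \<i>)) {..<2 * n} P"
    using finite_subset_of_circle_in_order[OF P(2,1)] unfolding P(3) by metis
  define z where "z i = w * exp (2 * pi * t i * \<i>)" for i
  have z_bij: "bij_betw z {..<2 * n} P" using bij by (simp add: z_def[abs_def])
  have zP: "z i \<in> P" if "i < 2 * n" for i
    using z_bij that by (auto simp: bij_betw_def)
  have z_eq: "z i = z j \<longleftrightarrow> i = j" if "i < 2 * n" "j < 2 * n" for i j
    using z_bij that by (auto simp: bij_betw_def dest: inj_onD)
  \<comment> \<open>Three consecutive endpoints cannot all belong to one chord, so \<open>h\<close> can be chosen as 0 or 1.\<close>
  have "\<exists>h c d. Suc h < 2 * n \<and> z h \<in> c \<and> c \<in> \<C> \<and> z (Suc h) \<in> d \<and> d \<in> \<C> \<and> c \<noteq> d"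
  proof -
    obtain c0 c1 c2 where c: "c0 \<in> \<C>" "z 0 \<in> c0" "c1 \<in> \<C>" "z 1 \<in> c1" "c2 \<in> \<C>" "z 2 \<in> c2"
      using zP[of 0] zP[of 1] zP[of 2] partition_onD1[OF P(4)] m by auto
    have "\<not> (c0 = c1 \<and> c1 = c2)"
    proof
      assume "c0 = c1 \<and> c1 = c2"
      then have "card {z 0, z 1, z 2} \<le> card c0"
        using c P(6)[of c0] by (intro card_mono) (auto intro: card_ge_0_finite)
      then show False using P(6)[OF c(1)] m by (simp add: z_eq)
    qed
    then show ?thesis
      using c m by (cases "c0 = c1")
       (auto simp: numeral_2_eq_2 intro: exI[of _ 0] exI[of _ 1])
  qed
  then obtain h c d where h: "Suc h < 2 * n" "z h \<in> c" "c \<in> \<C>" "z (Suc h) \<in> d" "d \<in> \<C>" "c \<noteq> d"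
    by blast
  obtain \<rho> where \<rho>: "bij_betw \<rho> P {..<2 * n}" "\<rho> (z h) = 0" "\<rho> (z (Suc h)) = 2 * m"
     "\<And>c. c \<in> \<C> \<Longrightarrow> \<exists>j<n. \<exists>a b. c = {a, b} \<and> \<rho> a = 2 * j \<and> \<rho> b = 2 * j + 1"
    using chord_labelling[OF P(4) _ P(6) P(2) _ h(2-6), of m] P(3,5) unfolding m(1) by metis
  obtain D where D: "crossing_pairs f n D"
     "inj_on D {..<4 * n} \<or> inj_on D ({..<4 * n} - {4 * m}) \<and> D (4 * m) = D 1"
    using crossings_covering_almost_all_vertices[OF assms(4), of m] assms(3) m by auto
  have \<pi>: "bij_betw (\<rho> \<circ> z) {..<2 * n} {..<2 * n}"
    using z_bij \<rho>(1) by (rule bij_betw_trans)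
  have "\<exists>v k. inj_on v {..<2 * (2 * n)} \<and> (\<forall>i<2 * n. Suc (k i) < 2 * (2 * n)) \<and>
    (\<forall>i. Suc i < 2 * n \<longrightarrow> k i < k (Suc i)) \<and>
     (\<forall>i<2 * n. v (k i) = D (2 * (\<rho> \<circ> z) i) \<and> v (Suc (k i)) = D (2 * (\<rho> \<circ> z) i + 1))"
    using D(2) \<rho>(2,3) h(1) assms(3)
    by (intro vertex_sequence_through_edges[where l = "2 * m" and h = h] \<pi>) simp_all
  then obtain v k where v: "inj_on v {..<4 * n}" and k: "\<And>i. i < 2 * n \<Longrightarrow> Suc (k i) < 4 * n"
     "\<And>i. Suc i < 2 * n \<Longrightarrow> k i < k (Suc i)"
     and vk: "\<And>i. i < 2 * n \<Longrightarrow> v (k i) = D (2 * \<rho> (z i)) \<and> v (Suc (k i)) = D (2 * \<rho> (z i) + 1)"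
    by auto
  let ?\<gamma> = "cyclic_graph (4 * n) v"
  let ?R = "realization (complete_graph :: 'v graph)"
  obtain X r where X: "\<And>j. j < n \<Longrightarrow> ?R \<inter> f -` {f (X (2 * j))} = {X (2 * j), X (2 * j + 1)}"
    and r: "\<And>e. e < 2 * n \<Longrightarrow> 0 < r e \<and> r e < (1::real) \<and>
       X e = (1 - r e) *\<^sub>R vertex_point (D (2 * e)) + r e *\<^sub>R vertex_point (D (2 * e + 1))"
    using crossing_points[OF D(1)] by blast
  have \<rho>_less: "\<rho> (z i) < 2 * n" if "i < 2 * n" for i
    using \<rho>(1) zP[OF that] by (auto simp: bij_betw_def)
  have "3 \<le> 4 * n" using m by simp
  have "\<exists>\<phi> \<phi>'. homeomorphism (sphere 0 1) (realization ?\<gamma>) \<phi> \<phi>' \<and>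
    (\<forall>i<2 * n. \<phi> (w * exp (2 * pi * t i * \<i>)) = (1 - r (\<rho> (z i))) *\<^sub>R vertex_point (v (k i)) +
        r (\<rho> (z i)) *\<^sub>R vertex_point (v (Suc (k i))))"
    using r[OF \<rho>_less] by (intro cyclic_graph_through_points v \<open>3 \<le> 4 * n\<close> w t k) simp_all
  then obtain \<phi> \<phi>' where hom: "homeomorphism (sphere 0 1) (realization ?\<gamma>) \<phi> \<phi>'"
    and \<phi>: "\<And>i. i < 2 * n \<Longrightarrow> \<phi> (z i) = (1 - r (\<rho> (z i))) *\<^sub>R vertex_point (v (k i)) +
        r (\<rho> (z i)) *\<^sub>R vertex_point (v (Suc (k i)))"
    unfolding z_def by blast
  have \<phi>_X: "\<phi> a = X (\<rho> a)" if "a \<in> P" for a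
  proof -
    obtain i where "i < 2 * n" "a = z i" using z_bij \<open>a \<in> P\<close> by (auto simp: bij_betw_def)
    then show ?thesis using \<phi> vk r \<rho>_less by metis
  qed
  have "\<exists>p. ?R \<inter> f -` {p} = \<phi> ` c" if "c \<in> \<C>" for c
  proof -
    obtain j a b where "j < n" "c = {a, b}" "\<rho> a = 2 * j" "\<rho> b = 2 * j + 1"
      using \<rho>(4)[OF \<open>c \<in> \<C>\<close>] by blast
    moreover from this have "a \<in> P" "b \<in> P" using partition_onD1[OF P(4)] \<open>c \<in> \<C>\<close> by auto
    ultimately have "?R \<inter> f -` {f (\<phi> a)} = \<phi> ` c"
      using X[of j] by (simp add: \<phi>_X)
    then show ?thesis by blast
  qed
  moreover have cyc: "cycle_of ?\<gamma> complete_graph"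
    using v \<open>3 \<le> 4 * n\<close> hom by (rule cycle_of_cyclic_graph)
  then have "realization ?\<gamma> \<subseteq> ?R" by (simp add: cycle_of_def realization_mono)
  ultimately have "sub_chord_diagram (realization ?\<gamma>) ((`) \<phi> ` \<C>) (chord_diagram_of_map f (realization ?\<gamma>))"
    "equivalent_chord_diagrams \<phi> (realization ?\<gamma>) ((`) \<phi> ` \<C>) id (sphere 0 1) \<C>"
    using transported_chord_diagram[OF hom assms(2)] by blast+
  moreover have "orientation_of \<phi> (realization ?\<gamma>)"
    using hom by (auto simp: orientation_of_def)
  ultimately show ?thesis
    using cyc card_verts_cyclic_graph[OF v] by blast
qed

end
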